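(* Let $\mathcal{S}_X,\mathcal{S}_Y$ be compact (hence complete and separable) metric spaces, let $\widetilde{c}:\mathcal{S}_X\times\mathcal{S}_Y\to[0,\infty)$ be lower semicontinuous, let $c:\mathcal{S}_X\times\mathcal{S}_X\to[0,\infty)$ be lower semicontinuous with $c(x,x)=0$ for all $x$, let $\mu_0$ and $\nu$ be Borel probability measures on $\mathcal{S}_X$ and $\mathcal{S}_Y$ respectively, and let $\delta\ge 0$. Then $$G_\delta(\mu_0,\nu)=\sup_{(\alpha,\beta)\in\mathcal{A}(\widetilde{c})}\ \min_{\mu\in\mathcal{D}_\delta(\mu_0)}\ \Big(\mathbb{E}_{\mu}\alpha(X)+\mathbb{E}_{\nu}\beta(Y)\Big).$$
   Context: For Borel probability measures $\mu$ on $\mathcal{S}_X$ and $\nu$ on $\mathcal{S}_Y$, let $\Pi_{X,Y}(\mu,\nu)$ be the set of Borel probability measures $\pi$ on $\mathcal{S}_X\times\mathcal{S}_Y$ with marginals $\mu$ and $\nu$, and let $D_{\widetilde{c}}(\mu,\nu)=\min\{\mathbb{E}_\pi\widetilde{c}(X,Y):\pi\in\Pi_{X,Y}(\mu,\nu)\}\in[0,\infty]$ be the optimal transport cost. Similarly, for Borel probability measures $\mu_0,\mu$ on $\mathcal{S}_X$, $D_c(\mu_0,\mu)=\min\{\mathbb{E}_\pi c(W,X)\}$ over couplings $\pi$ of $W\sim\mu_0$ and $X\sim\mu$. Define $\mathcal{D}_\delta(\mu_0)=\{\mu: D_c(\mu_0,\mu)\le\delta\}$ (a set of Borel probability measures on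 $\mathcal{S}_X$), and $$G_\delta(\mu_0,\nu)=\min\{D_{\widetilde{c}}(\mu,\nu):\mu\in\mathcal{D}_\delta(\mu_0)\}.$$ With $C(\mathcal{S})$ the space of continuous real functions on $\mathcal{S}$, let $$\mathcal{A}(\widetilde{c})=\{(\alpha,\beta)\in C(\mathcal{S}_X)\times C(\mathcal{S}_Y):\alpha(x)+\beta(y)\le\widetilde{c}(x,y)\ \text{for all }x\in\mathcal{S}_X,\,y\in\mathcal{S}_Y\}.$$ Values are allowed to be $+\infty$. *)

theory Defs
  imports "HOL-Probability.Probability"
begin

definition lower_semicontinuous :: "('a::topological_space \<Rightarrow> real) \<Rightarrow> bool" where
  "lower_semicontinuous f \<longleftrightarrow> (\<forall>x. \<forall>t < f x. \<forall>\<^sub>F y in nhds x. t < f y)"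

abbreviation borel_probs :: "'a::topological_space measure set" where
  "borel_probs \<equiv> space (prob_algebra borel)"

text \<open>
  Couplings live on the Borel sigma-algebra of the product topology.  For arbitrary topological
  spaces this may be strictly larger than the product of the Borel sigma-algebras; the two agree
  for compact metric spaces.
\<close>

definition couplings ::
  "'a::topological_space measure \<Rightarrow> 'b::topological_space measure \<Rightarrow> ('a \<times> 'b) measure set" where
  "couplings \<mu> \<nu> = {\<pi> \<in> borel_probs. distr \<pi> borel fst = \<mu> \<and> distr \<pi> borel snd = \<nu>}"

definition transport_cost :: "('a \<times> 'b \<Rightarrow> real) \<Rightarrow> ('a \<times> 'b) measure \<Rightarrow> ennreal" where
  "transport_cost c \<pi> = (\<integral>\<^sup>+ z. ennreal (c z) \<partial>\<pi>)"

text \<open>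
  The minima are defined as infima in the complete lattice of extended nonnegative reals; that they
  are attained is a separate claim.
\<close>

definition ot_cost ::
  "('a::topological_space \<times> 'b::topological_space \<Rightarrow> real) \<Rightarrow> 'a measure \<Rightarrow> 'b measure \<Rightarrow> ennreal" where
  "ot_cost c \<mu> \<nu> = (INF \<pi>\<in>couplings \<mu> \<nu>. transport_cost c \<pi>)"

definition ot_ball ::
  "('a::topological_space \<times> 'a \<Rightarrow> real) \<Rightarrow> real \<Rightarrow> 'a measure \<Rightarrow> 'a measure set" where
  "ot_ball c \<delta> \<mu>0 = {\<mu> \<in> borel_probs. ot_cost c \<mu>0 \<mu> \<le> ennreal \<delta>}"

definition robust_ot ::
  "('a::topological_space \<times> 'b::topological_space \<Rightarrow> real) \<Rightarrow> ('a \<times> 'a \<Rightarrow> real) \<Rightarrow> real \<Rightarrow>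
    'a measure \<Rightarrow> 'b measure \<Rightarrow> ennreal" where
  "robust_ot c' c \<delta> \<mu>0 \<nu> = (INF \<mu>\<in>ot_ball c \<delta> \<mu>0. ot_cost c' \<mu> \<nu>)"

definition dual_feasible ::
  "('a::topological_space \<times> 'b::topological_space \<Rightarrow> real) \<Rightarrow> (('a \<Rightarrow> real) \<times> ('b \<Rightarrow> real)) set" where
  "dual_feasible c' = {(\<alpha>, \<beta>). continuous_on UNIV \<alpha> \<and> continuous_on UNIV \<beta> \<and>
     (\<forall>x y. \<alpha> x + \<beta> y \<le> c' (x, y))}"

definition dual_value ::
  "'a measure \<Rightarrow> 'b measure \<Rightarrow> ('a \<Rightarrow> real) \<Rightarrow> ('b \<Rightarrow> real) \<Rightarrow> real" where
  "dual_value \<mu> \<nu> \<alpha> \<beta> = (\<integral>x. \<alpha> x \<partial>\<mu>) + (\<integral>y. \<beta> y \<partial>\<nu>)"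

end

theory Submission
  imports Defs
begin

text \<open>
  On a compact metric space, probability measures are the normalised positive linear functionals on
  continuous functions (Riesz), and these form a compact convex set in the topology of pointwise
  convergence. Dualise at once the two marginal constraints (multipliers \<open>\<phi>\<close>, \<open>\<beta>\<close>) and the lower
  semicontinuous cost (continuous minorants \<open>h \<le> c'\<close>): the Lagrangian
  \<open>\<integral>(h - \<phi> - \<beta>) d\<pi> + \<integral>\<phi> d\<mu> + \<integral>\<beta> d\<nu>\<close>, minimised over unconstrained \<open>\<pi>\<close>, is the dual value of the
  feasible pair \<open>(\<phi> + min (h - \<phi> - \<beta>), \<beta>)\<close>. Hence if every feasible pair has dual value at most \<open>t\<close>
  at some \<open>\<mu>\<close> of a compact convex set, a minimax argument gives a single \<open>\<mu>\<close> in that set with a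
  coupling of cost at most \<open>t\<close>. For a one-point set this is Kantorovich duality with attainment;
  applied to \<open>c\<close>, it exhibits the transport ball as compact and convex; for the ball it is the claim.
\<close>

section \<open>Normalised positive functionals on continuous functions\<close>

text \<open>Functionals are total on all real functions, so that they live in one function space
  whose product topology makes every evaluation continuous.\<close>

definition states :: "(('a::topological_space \<Rightarrow> real) \<Rightarrow> real) set" where
  "states = {T.
     (\<forall>f. \<not> continuous_on UNIV f \<longrightarrow> T f = 0) \<and>
     (\<forall>f g. continuous_on UNIV f \<longrightarrow> continuous_on UNIV g \<longrightarrow> T (\<lambda>x. f x + g x) = T f + T g) \<and>
     (\<forall>a f. continuous_on UNIV f \<longrightarrow> T (\<lambda>x. a * f x) = a * T f) \<and>
     (\<forall>f. continuous_on UNIV f \<longrightarrow> (\<forall>x. 0 \<le> f x) \<longrightarrow> 0 \<le> T f) \<and>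
     T (\<lambda>x. 1) = 1}"

context
  fixes T :: "('a::topological_space \<Rightarrow> real) \<Rightarrow> real"
  assumes T: "T \<in> states"
begin

lemma state_add:
  "continuous_on UNIV f \<Longrightarrow> continuous_on UNIV g \<Longrightarrow> T (\<lambda>x. f x + g x) = T f + T g"
  using T by (simp add: states_def)

lemma state_cmult: "continuous_on UNIV f \<Longrightarrow> T (\<lambda>x. a * f x) = a * T f"
  using T by (simp add: states_def)

lemma state_nonneg: "continuous_on UNIV f \<Longrightarrow> (\<And>x. 0 \<le> f x) \<Longrightarrow> 0 \<le> T f"
  using T by (simp add: states_def)

lemma state_const: "T (\<lambda>x. a) = a"
proof -
  have "T (\<lambda>x. a * 1) = a * T (\<lambda>x. 1)" by (rule state_cmult) auto
  then show ?thesis using T by (simp add: states_def)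
qed

lemma state_diff:
  assumes "continuous_on UNIV f" "continuous_on UNIV g"
  shows "T (\<lambda>x. f x - g x) = T f - T g"
proof -
  have "T (\<lambda>x. f x + -1 * g x) = T f + T (\<lambda>x. -1 * g x)"
    by (intro state_add assms continuous_intros)
  also have "T (\<lambda>x. -1 * g x) = -1 * T g"
    by (intro state_cmult assms)
  finally show ?thesis by simp
qed

lemma state_mono:
  assumes "continuous_on UNIV f" "continuous_on UNIV g" "\<And>x. f x \<le> g x"
  shows "T f \<le> T g"
  using state_nonneg[of "\<lambda>x. g x - f x"] state_diff[of g f] assms
  by (simp add: continuous_on_diff)

lemma state_sum:
  assumes "finite I" "\<And>i. i \<in> I \<Longrightarrow> continuous_on UNIV (f i)"
  shows "T (\<lambda>x. \<Sum>i\<in>I. f i x) = (\<Sum>i\<in>I. T (f i))"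
  using assms
proof (induction I rule: finite_induct)
  case empty
  show ?case using state_const[of 0] by simp
next
  case (insert i I)
  then show ?case
    using state_add[of "f i" "\<lambda>x. \<Sum>i\<in>I. f i x"] by (simp add: continuous_on_sum)
qed

end

section \<open>Riesz representation on compact metric spaces\<close>

text \<open>Sequences of continuous functions take the place of covers by open sets, so
  \<open>T\<close> can be applied to a cover term by term. Sums are taken in \<open>ennreal\<close>,
  where divergence is harmless.\<close>

definition sum_covers :: "'a::topological_space set \<Rightarrow> (nat \<Rightarrow> 'a \<Rightarrow> real) set" where
  "sum_covers A = {f. (\<forall>n. continuous_on UNIV (f n)) \<and> (\<forall>n x. 0 \<le> f n x) \<and>
     (\<forall>x\<in>A. 1 \<le> (\<Sum>n. ennreal (f n x)))}"

definition state_outer :: "(('a::topological_space \<Rightarrow> real) \<Rightarrow> real) \<Rightarrow> 'a set \<Rightarrow> ennreal" where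
  "state_outer T A = (INF f\<in>sum_covers A. \<Sum>n. ennreal (T (f n)))"

text \<open>Nonnegative sums may be rearranged, so \<open>prod_decode\<close> lists a doubly indexed
  cover as one sequence with the same pointwise sum and the same cost. Countable subadditivity and
  the splitting by a closed set both produce such covers.\<close>

lemma state_outer_le_double:
  fixes F :: "nat \<Rightarrow> nat \<Rightarrow> 'a::topological_space \<Rightarrow> real"
  assumes "\<And>i n. continuous_on UNIV (F i n)" and "\<And>i n x. 0 \<le> F i n x"
    and "\<And>x. x \<in> A \<Longrightarrow> 1 \<le> (\<Sum>i. \<Sum>n. ennreal (F i n x))"
  shows "state_outer T A \<le> (\<Sum>i. \<Sum>n. ennreal (T (F i n)))"
proof -
  let ?f = "\<lambda>k. F (fst (prod_decode k)) (snd (prod_decode k))"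
  have eq: "(\<Sum>k. ennreal (?f k x)) = (\<Sum>i. \<Sum>n. ennreal (F i n x))" for x
    using suminf_ennreal_2dimen[of "\<lambda>m. \<Sum>n. ennreal (F m n x)" "\<lambda>(i,n). ennreal (F i n x)"]
    by (simp add: case_prod_unfold)
  have eqT: "(\<Sum>k. ennreal (T (?f k))) = (\<Sum>i. \<Sum>n. ennreal (T (F i n)))"
    using suminf_ennreal_2dimen[of "\<lambda>m. \<Sum>n. ennreal (T (F m n))" "\<lambda>(i,n). ennreal (T (F i n))"]
    by (simp add: case_prod_unfold)
  have "?f \<in> sum_covers A"
    using assms by (auto simp: sum_covers_def eq)
  then show ?thesis
    unfolding state_outer_def eqT[symmetric] by (rule INF_lower)
qed

lemma continuous_on_If_const:
  "continuous_on A f \<Longrightarrow> continuous_on A g \<Longrightarrow> continuous_on A (\<lambda>x. if b then f x else g x)"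
  by (cases b) auto

text \<open>The function followed by zeros is a cover, and the zeros cost nothing.\<close>

lemma state_outer_le_single:
  assumes "T \<in> states" and "continuous_on UNIV f" and "\<And>x. 0 \<le> f x" and "\<And>x. x \<in> A \<Longrightarrow> 1 \<le> f x"
  shows "state_outer T A \<le> ennreal (T f)"
proof -
  let ?f = "\<lambda>n x. if n = 0 then f x else 0 :: real"
  have T0: "T (\<lambda>x. 0) = 0" using state_const[OF assms(1), of 0] .
  have "(\<Sum>n. ennreal (?f n x)) = ennreal (f x)" for x
    by (subst suminf_finite[of "{0}"]) auto
  then have "?f \<in> sum_covers A"
    using assms
    by (auto simp: sum_covers_def continuous_on_If_const simp flip: ennreal_1 intro!: ennreal_leI)
  then have "state_outer T A \<le> (\<Sum>n. ennreal (T (?f n)))"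
    unfolding state_outer_def by (rule INF_lower)
  also have "\<dots> = ennreal (T f)"
    by (subst suminf_finite[of "{0}"]) (auto simp: T0)
  finally show ?thesis .
qed

lemma outer_measure_space_state_outer:
  assumes T: "T \<in> states"
  shows "outer_measure_space (Pow UNIV) (state_outer T)"
  unfolding outer_measure_space_def
proof (intro conjI)
  show "positive (Pow UNIV) (state_outer T)"
    using state_outer_le_single[OF T, of "\<lambda>x. 0" "{}"] state_const[OF T, of 0]
    by (simp add: positive_def)
  show "increasing (Pow UNIV) (state_outer T)"
    unfolding increasing_def state_outer_def
    by (auto simp: sum_covers_def intro!: INF_superset_mono)
  show "countably_subadditive (Pow UNIV) (state_outer T)"
    unfolding countably_subadditive_def
  proof safe
    fix A :: "nat \<Rightarrow> 'a set"
    show "state_outer T (\<Union>i. A i) \<le> (\<Sum>i. state_outer T (A i))"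
    proof (rule ennreal_le_epsilon)
      fix e :: real
      assume top: "(\<Sum>i. state_outer T (A i)) < top" and e: "0 < e"
      \<comment> \<open>Near-optimal covers; the slacks \<open>e * (1/2)^Suc i\<close> add up to
        \<open>e\<close>.\<close>
      have "\<exists>f\<in>sum_covers (A i). (\<Sum>n. ennreal (T (f n))) \<le> state_outer T (A i) + ennreal (e * (1/2)^Suc i)"
        for i
      proof -
        \<comment> \<open>Only a finite infimum is strictly increased by adding the slack.\<close>
        have "state_outer T (A i) \<noteq> top"
          using ennreal_suminf_lessD[OF top, of i] by simp
        then have "state_outer T (A i) < state_outer T (A i) + ennreal (e * (1/2)^Suc i)"
          using e by (simp add: ennreal_add_left_cancel_less flip: less_top)
        then show ?thesis
          unfolding state_outer_def[of T "A i"] INF_less_iff by (auto intro: less_imp_le)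
      qed
      then obtain F where F: "\<And>i. F i \<in> sum_covers (A i)"
        "\<And>i. (\<Sum>n. ennreal (T (F i n))) \<le> state_outer T (A i) + ennreal (e * (1/2)^Suc i)"
        by metis
      have "state_outer T (\<Union>i. A i) \<le> (\<Sum>i. \<Sum>n. ennreal (T (F i n)))"
      proof (rule state_outer_le_double)
        fix x assume "x \<in> (\<Union>i. A i)"
        then obtain i where "x \<in> A i" by auto
        then have "1 \<le> (\<Sum>n. ennreal (F i n x))"
          using F(1)[of i] by (auto simp: sum_covers_def)
        also have "\<dots> \<le> (\<Sum>i. \<Sum>n. ennreal (F i n x))"
          using sum_le_suminf[of "\<lambda>i. \<Sum>n. ennreal (F i n x)" "{i}"] by simp
        finally show "1 \<le> (\<Sum>i. \<Sum>n. ennreal (F i n x))" .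
      qed (use F(1) in \<open>auto simp: sum_covers_def\<close>)
      also have "\<dots> \<le> (\<Sum>i. state_outer T (A i) + ennreal (e * (1/2)^Suc i))"
        by (intro suminf_le F(2)) auto
      also have "\<dots> = (\<Sum>i. state_outer T (A i)) + (\<Sum>i. ennreal (e * (1/2)^Suc i))"
        by (intro suminf_add[symmetric]) auto
      also have "(\<Sum>i. ennreal (e * (1/2)^Suc i)) = ennreal (e * 1)"
        by (rule suminf_ennreal_eq[OF _ sums_mult[OF power_half_series]])
           (use e in \<open>intro mult_nonneg_nonneg zero_le_power, auto\<close>)
      finally show "state_outer T (\<Union>i. A i) \<le> (\<Sum>i. state_outer T (A i)) + ennreal e" by simp
    qed
  qed
qed

text \<open>Beware that \<open>infdist x {} = 0\<close>, so all cutoffs of the empty set are constantly 1.\<close>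

definition dist_cutoff :: "'a::metric_space set \<Rightarrow> nat \<Rightarrow> 'a \<Rightarrow> real" where
  "dist_cutoff C k x = max 0 (1 - real k * infdist x C)"

lemma dist_cutoff_0 [simp]: "dist_cutoff C 0 x = 1"
  by (simp add: dist_cutoff_def)

lemma dist_cutoff_nonneg: "0 \<le> dist_cutoff C k x"
  by (simp add: dist_cutoff_def)

lemma dist_cutoff_le_1: "dist_cutoff C k x \<le> 1"
  by (simp add: dist_cutoff_def infdist_nonneg)

lemma dist_cutoff_eq_1: "x \<in> C \<Longrightarrow> dist_cutoff C k x = 1"
  by (simp add: dist_cutoff_def)

lemma dist_cutoff_Suc_le: "dist_cutoff C (Suc k) x \<le> dist_cutoff C k x"
  unfolding dist_cutoff_def
  by (intro max.mono diff_mono mult_right_mono infdist_nonneg) auto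

lemma continuous_on_dist_cutoff: "continuous_on A (dist_cutoff C k)"
  unfolding dist_cutoff_def by (intro continuous_intros)

lemma dist_cutoff_tendsto:
  assumes "closed C" "C \<noteq> {}"
  shows "(\<lambda>k. dist_cutoff C k x) \<longlonglongrightarrow> indicator C x"
proof (cases "x \<in> C")
  case True
  then show ?thesis by (simp add: dist_cutoff_eq_1)
next
  case False
  then have pos: "infdist x C > 0"
    using assms by (simp add: infdist_pos_not_in_closed)
  then obtain N :: nat where N: "1 / infdist x C < real N"
    using reals_Archimedean2 by blast
  have "dist_cutoff C k x = 0" if "k \<ge> N" for k
  proof -
    have "1 < real N * infdist x C" using N pos by (simp add: field_simps)
    also have "\<dots> \<le> real k * infdist x C" using that pos by (simp add: mult_right_mono)
    finally show ?thesis by (simp add: dist_cutoff_def)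
  qed
  then have "eventually (\<lambda>k. dist_cutoff C k x = 0) sequentially"
    by (auto simp: eventually_sequentially)
  then show ?thesis using False by (simp add: tendsto_eventually)
qed

text \<open>The increments of the cutoffs sum to 1 off \<open>C\<close>. Multiplying a cover of \<open>A\<close> by the \<open>k\<close>-th cutoff
  and by the first \<open>k\<close> increments splits its cost exactly; letting \<open>k\<close> grow, it yields covers of
  \<open>C \<inter> A\<close> and of \<open>A - C\<close> of no larger total cost.\<close>

lemma closed_in_lambda_system_state_outer:
  fixes C :: "'a::metric_space set"
  assumes T: "T \<in> states" and C: "closed C"
  shows "C \<in> lambda_system UNIV (Pow UNIV) (state_outer T)"
proof (cases "C = {}")
  case True
  then show ?thesis
    using outer_measure_space_state_outer[OF T]
    by (auto simp: lambda_system_def outer_measure_space_def positive_def)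
next
  case nonempty: False
  define \<psi> where "\<psi> j x = dist_cutoff C j x - dist_cutoff C (Suc j) x" for j and x :: 'a
  have \<psi>_cont: "continuous_on UNIV (\<psi> j)" for j
    unfolding \<psi>_def by (intro continuous_intros continuous_on_dist_cutoff)
  have \<psi>_nonneg: "0 \<le> \<psi> j x" for j x
    using dist_cutoff_Suc_le by (simp add: \<psi>_def)
  have \<psi>_sum: "(\<Sum>j<k. \<psi> j x) = 1 - dist_cutoff C k x" for k x
    unfolding \<psi>_def by (subst sum_lessThan_telescope') simp
  have \<psi>_suminf: "(\<Sum>j. ennreal (\<psi> j x)) = 1" if "x \<notin> C" for x
  proof -
    have "(\<lambda>k. 1 - dist_cutoff C k x) \<longlonglongrightarrow> 1 - indicator C x"
      by (intro tendsto_intros dist_cutoff_tendsto C nonempty)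
    then have "(\<lambda>j. \<psi> j x) sums 1"
      using that by (simp add: sums_def \<psi>_sum)
    from suminf_ennreal_eq[OF \<psi>_nonneg this] show ?thesis
      by (simp only: ennreal_1)
  qed
  have "state_outer T (C \<inter> A) + state_outer T ((UNIV - C) \<inter> A) \<le> (\<Sum>n. ennreal (T (f n)))"
    if f: "f \<in> sum_covers A" for A f
  proof -
    have fc: "continuous_on UNIV (f n)" and f0: "0 \<le> f n x" for n x
      using f by (auto simp: sum_covers_def)
    have f1: "1 \<le> (\<Sum>n. ennreal (f n x))" if "x \<in> A" for x
      using f that by (auto simp: sum_covers_def)
    define R where "R j = (\<Sum>n. ennreal (T (\<lambda>x. \<psi> j x * f n x)))" for j
    have out: "state_outer T ((UNIV - C) \<inter> A) \<le> (\<Sum>j. R j)"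
      unfolding R_def
    proof (rule state_outer_le_double)
      fix x assume x: "x \<in> (UNIV - C) \<inter> A"
      \<comment> \<open>Off \<open>C\<close> the double sum factors into the sum of the increments,
        which is 1, and the sum of the cover.\<close>
      have "(\<Sum>j. \<Sum>n. ennreal (\<psi> j x * f n x)) = (\<Sum>j. \<Sum>n. ennreal (\<psi> j x) * ennreal (f n x))"
        by (simp add: ennreal_mult \<psi>_nonneg f0)
      also have "\<dots> = (\<Sum>j. ennreal (\<psi> j x)) * (\<Sum>n. ennreal (f n x))"
        by simp
      finally show "1 \<le> (\<Sum>j. \<Sum>n. ennreal (\<psi> j x * f n x))"
        using \<psi>_suminf[of x] x f1[of x] by simp
    qed (auto intro!: continuous_intros \<psi>_cont fc simp: \<psi>_nonneg f0)
    have "state_outer T (C \<inter> A) + (\<Sum>j<k. R j) \<le> (\<Sum>n. ennreal (T (f n)))" for k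
    proof -
      have "(\<lambda>n x. dist_cutoff C k x * f n x) \<in> sum_covers (C \<inter> A)"
        using fc f0 f1 by (auto simp: sum_covers_def dist_cutoff_nonneg dist_cutoff_eq_1
            intro!: continuous_intros continuous_on_dist_cutoff)
      then have "state_outer T (C \<inter> A) \<le> (\<Sum>n. ennreal (T (\<lambda>x. dist_cutoff C k x * f n x)))"
        unfolding state_outer_def by (rule INF_lower)
      moreover have "(\<Sum>j<k. R j) = (\<Sum>n. ennreal (T (\<lambda>x. (1 - dist_cutoff C k x) * f n x)))"
      proof -
        have "(\<Sum>j<k. R j) = (\<Sum>n. \<Sum>j<k. ennreal (T (\<lambda>x. \<psi> j x * f n x)))"
          unfolding R_def by (rule suminf_sum[symmetric]) auto
        moreover have "(\<Sum>j<k. ennreal (T (\<lambda>x. \<psi> j x * f n x))) =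
            ennreal (T (\<lambda>x. (1 - dist_cutoff C k x) * f n x))" for n
        proof -
          have "(\<Sum>j<k. ennreal (T (\<lambda>x. \<psi> j x * f n x))) = ennreal (\<Sum>j<k. T (\<lambda>x. \<psi> j x * f n x))"
            by (intro sum_ennreal state_nonneg[OF T] continuous_intros \<psi>_cont fc
                mult_nonneg_nonneg \<psi>_nonneg f0)
          also have "(\<Sum>j<k. T (\<lambda>x. \<psi> j x * f n x)) = T (\<lambda>x. \<Sum>j<k. \<psi> j x * f n x)"
            by (intro state_sum[OF T, symmetric] continuous_intros \<psi>_cont fc) auto
          finally show ?thesis by (simp add: \<psi>_sum flip: sum_distrib_right)
        qed
        ultimately show ?thesis by simp
      qed
      moreover have "(\<Sum>n. ennreal (T (\<lambda>x. dist_cutoff C k x * f n x))) +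
          (\<Sum>n. ennreal (T (\<lambda>x. (1 - dist_cutoff C k x) * f n x))) = (\<Sum>n. ennreal (T (f n)))"
      proof -
        have "ennreal (T (\<lambda>x. dist_cutoff C k x * f n x)) +
          ennreal (T (\<lambda>x. (1 - dist_cutoff C k x) * f n x)) = ennreal (T (f n))" for n
        proof -
          have c: "continuous_on UNIV (\<lambda>x. dist_cutoff C k x * f n x)"
            "continuous_on UNIV (\<lambda>x. (1 - dist_cutoff C k x) * f n x)"
            by (intro continuous_intros continuous_on_dist_cutoff fc)+
          have "0 \<le> T (\<lambda>x. dist_cutoff C k x * f n x)" "0 \<le> T (\<lambda>x. (1 - dist_cutoff C k x) * f n x)"
            using state_nonneg[OF T c(1)] state_nonneg[OF T c(2)]
            by (auto simp: dist_cutoff_nonneg dist_cutoff_le_1 f0)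
          then show ?thesis
            using state_add[OF T c] by (simp add: algebra_simps flip: ennreal_plus)
        qed
        then show ?thesis
          by (simp add: suminf_add)
      qed
      ultimately show ?thesis
        by (metis add_right_mono)
    qed
    \<comment> \<open>The first term is free of \<open>k\<close>, so only the partial sums of
      \<open>R\<close> pass to the limit.\<close>
    then have "(SUP k. state_outer T (C \<inter> A) + (\<Sum>j<k. R j)) \<le> (\<Sum>n. ennreal (T (f n)))"
      by (intro SUP_least)
    also have "(SUP k. state_outer T (C \<inter> A) + (\<Sum>j<k. R j)) = state_outer T (C \<inter> A) + (\<Sum>j. R j)"
      by (subst ennreal_SUP_add_right[symmetric]) (auto simp: suminf_eq_SUP)
    finally show ?thesis
      using out by (meson add_left_mono order_trans)
  qed
  then have le: "state_outer T (C \<inter> A) + state_outer T ((UNIV - C) \<inter> A) \<le> state_outer T A" for A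
    unfolding state_outer_def[of T A] by (rule INF_greatest)
  interpret sigma_algebra UNIV "Pow UNIV :: 'a set set" by (rule sigma_algebra_Pow)
  have "state_outer T A \<le> state_outer T (C \<inter> A) + state_outer T ((UNIV - C) \<inter> A)" for A
  proof -
    have "subadditive (Pow UNIV) (state_outer T)"
      using countably_subadditive_subadditive outer_measure_space_state_outer[OF T]
      by (simp add: outer_measure_space_def)
    moreover have "(C \<inter> A) \<union> ((UNIV - C) \<inter> A) = A" by auto
    ultimately show ?thesis
      using subadditiveD[of "Pow UNIV" "state_outer T" "C \<inter> A" "(UNIV - C) \<inter> A"] by auto
  qed
  with le show ?thesis
    unfolding lambda_system_def by (auto intro: antisym)
qed

section \<open>Integrals of continuous functions and uniqueness of the measure\<close>

lemma mem_borel_probs_iff: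
  "\<mu> \<in> borel_probs \<longleftrightarrow> sets \<mu> = sets borel \<and> prob_space \<mu>"
  by (simp add: space_prob_algebra)

lemma space_borel_probs: "\<mu> \<in> borel_probs \<Longrightarrow> space \<mu> = UNIV"
  using sets_eq_imp_space_eq[of \<mu> borel] by (simp add: mem_borel_probs_iff)

lemma continuous_on_compact_bound:
  fixes f :: "'a::topological_space \<Rightarrow> real"
  assumes "compact (UNIV :: 'a set)" "continuous_on UNIV f"
  obtains B where "0 < B" "\<And>x. \<bar>f x\<bar> \<le> B"
proof -
  have "bounded (range f)"
    using compact_continuous_image[OF assms(2,1)] by (rule compact_imp_bounded)
  then show ?thesis
    using that by (auto simp: bounded_pos)
qed

lemma measurable_continuous_borel_probs:
  "\<mu> \<in> borel_probs \<Longrightarrow> continuous_on UNIV f \<Longrightarrow> f \<in> borel_measurable \<mu>"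
  using borel_measurable_continuous_onI[of f]
  by (simp add: mem_borel_probs_iff cong: measurable_cong_sets)

lemma integrable_continuous_bounded:
  fixes f :: "'a::topological_space \<Rightarrow> real"
  assumes "\<mu> \<in> borel_probs" "continuous_on UNIV f" "\<And>x. \<bar>f x\<bar> \<le> B"
  shows "integrable \<mu> f"
proof -
  interpret prob_space \<mu> using assms(1) by (simp add: mem_borel_probs_iff)
  show ?thesis
    using assms measurable_continuous_borel_probs[of \<mu> f]
    by (intro integrable_const_bound[of _ B]) auto
qed

lemma integrable_continuous:
  fixes f :: "'a::topological_space \<Rightarrow> real"
  assumes "compact (UNIV :: 'a set)" "\<mu> \<in> borel_probs" "continuous_on UNIV f"
  shows "integrable \<mu> f"
  using continuous_on_compact_bound[OF assms(1,3)] integrable_continuous_bounded assms by metis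

text \<open>The cutoffs of a nonempty closed set are continuous and converge boundedly to its
  indicator, so integrals of continuous functions fix the measure of closed sets, an
  intersection-stable generator of the Borel sets.\<close>

lemma borel_probs_eqI:
  fixes \<mu> \<nu> :: "'a::metric_space measure"
  assumes \<mu>: "\<mu> \<in> borel_probs" and \<nu>: "\<nu> \<in> borel_probs"
    and eq: "\<And>f :: 'a \<Rightarrow> real. continuous_on UNIV f \<Longrightarrow> (\<integral>x. f x \<partial>\<mu>) = (\<integral>x. f x \<partial>\<nu>)"
  shows "\<mu> = \<nu>"
proof -
  interpret M: prob_space \<mu> using \<mu> by (simp add: mem_borel_probs_iff)
  interpret N: prob_space \<nu> using \<nu> by (simp add: mem_borel_probs_iff)
  have lim: "(\<lambda>k. \<integral>x. dist_cutoff C k x \<partial>\<kappa>) \<longlonglongrightarrow> measure \<kappa> C"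
    if \<kappa>: "\<kappa> \<in> borel_probs" and C: "closed C" "C \<noteq> {}" for \<kappa> and C :: "'a set"
  proof -
    interpret K: prob_space \<kappa> using \<kappa> by (simp add: mem_borel_probs_iff)
    have s: "C \<in> sets \<kappa>" using \<kappa> C by (simp add: mem_borel_probs_iff borel_closed)
    have "(\<lambda>k. \<integral>x. dist_cutoff C k x \<partial>\<kappa>) \<longlonglongrightarrow> (\<integral>x. indicator C x \<partial>\<kappa>)"
      using s \<kappa> C
      by (intro integral_dominated_convergence[where w = "\<lambda>x. 1"])
         (auto simp: dist_cutoff_nonneg dist_cutoff_le_1 continuous_on_dist_cutoff
           intro!: dist_cutoff_tendsto measurable_continuous_borel_probs)
    then show ?thesis using s by (simp add: space_borel_probs[OF \<kappa>])
  qed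
  have closed: "emeasure \<mu> C = emeasure \<nu> C" if C: "closed C" for C
  proof (cases "C = {}")
    case False
    have "measure \<mu> C = measure \<nu> C"
      using lim[OF \<mu> C False] lim[OF \<nu> C False] eq[OF continuous_on_dist_cutoff]
      by (simp add: LIMSEQ_unique)
    then show ?thesis by (simp add: M.emeasure_eq_measure N.emeasure_eq_measure)
  qed simp
  have sets: "sets borel = sigma_sets UNIV (Collect closed :: 'a set set)"
    by (simp add: borel_eq_closed)
  show ?thesis
  proof (rule measure_eqI_generator_eq[where E = "Collect closed" and \<Omega> = UNIV and A = "\<lambda>_. UNIV"])
    show "Int_stable (Collect closed :: 'a set set)"
      by (auto simp: Int_stable_def)
    show "sets \<mu> = sigma_sets UNIV (Collect closed)" "sets \<nu> = sigma_sets UNIV (Collect closed)"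
      using \<mu> \<nu> sets by (auto simp: mem_borel_probs_iff)
  qed (auto simp: closed)
qed

section \<open>The measure representing a state\<close>

text \<open>Layer cake: the \<open>j\<close>-th summand is the part of \<open>y\<close> between the
  heights \<open>j\<close> and \<open>j + 1\<close>.\<close>

lemma sum_clamp:
  fixes y :: real
  assumes "0 \<le> y"
  shows "(\<Sum>j<n. max 0 (min 1 (y - real j))) = min y (real n)"
  using assms by (induction n) (auto simp: min_def max_def)

text \<open>Compactness is used as in Dini's theorem: finitely many terms of a cover already exceed
  \<open>1 - e\<close> everywhere, and \<open>T\<close> is monotone and finitely additive.\<close>

lemma state_outer_UNIV:
  fixes T :: "('a::metric_space \<Rightarrow> real) \<Rightarrow> real"
  assumes K: "compact (UNIV :: 'a set)" and T: "T \<in> states"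
  shows "state_outer T UNIV = 1"
proof (rule antisym)
  show "state_outer T UNIV \<le> 1"
    using state_outer_le_single[OF T, of "\<lambda>x. 1" UNIV] state_const[OF T, of 1] by simp
  show "1 \<le> state_outer T UNIV"
    unfolding state_outer_def
  proof (rule INF_greatest, rule ennreal_le_epsilon)
    fix f and e :: real
    assume f: "f \<in> sum_covers (UNIV :: 'a set)" and e: "0 < e"
    have fc: "continuous_on UNIV (f n)" and f0: "0 \<le> f n x" for n x
      using f by (auto simp: sum_covers_def)
    define U where "U N = {x. 1 - e < (\<Sum>n<N. f n x)}" for N
    have U_open: "open (U N)" for N
      unfolding U_def by (intro open_Collect_less continuous_intros fc)
    have U_mono: "U N \<subseteq> U N'" if "N \<le> N'" for N N'
    proof
      fix x assume "x \<in> U N"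
      moreover have "(\<Sum>n<N. f n x) \<le> (\<Sum>n<N'. f n x)"
        using that f0 by (intro sum_mono2) auto
      ultimately show "x \<in> U N'" by (simp add: U_def)
    qed
    have "x \<in> (\<Union>N. U N)" for x
    proof -
      have "ennreal (1 - e) < 1" using e by (simp add: ennreal_less_one_iff)
      also have "1 \<le> (\<Sum>n. ennreal (f n x))" using f by (auto simp: sum_covers_def)
      finally obtain N where "ennreal (1 - e) < (\<Sum>n<N. ennreal (f n x))"
        by (auto simp: suminf_eq_SUP less_SUP_iff)
      then have "ennreal (1 - e) < ennreal (\<Sum>n<N. f n x)"
        using f0 by simp
      then have "1 - e < (\<Sum>n<N. f n x)"
        by (metis ennreal_leI not_le)
      then show ?thesis by (auto simp: U_def)
    qed
    then have "UNIV \<subseteq> (\<Union>N\<in>UNIV. U N)" by auto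
    then obtain I where I: "finite I" "UNIV \<subseteq> (\<Union>N\<in>I. U N)"
      using compactE_image[OF K, of UNIV U] U_open by auto
    have "I \<noteq> {}" using I by auto
    have all: "x \<in> U (Max I)" for x
      using I U_mono[OF Max_ge[OF I(1)]] by auto
    have "1 - e = T (\<lambda>x. 1 - e)" by (simp add: state_const[OF T])
    also have "\<dots> \<le> T (\<lambda>x. \<Sum>n<Max I. f n x)"
      using all by (intro state_mono[OF T] continuous_intros fc) (auto simp: U_def less_imp_le)
    also have "\<dots> = (\<Sum>n<Max I. T (f n))"
      by (intro state_sum[OF T] fc) auto
    finally have "ennreal (1 - e) \<le> ennreal (\<Sum>n<Max I. T (f n))"
      by (rule ennreal_leI)
    also have "\<dots> = (\<Sum>n<Max I. ennreal (T (f n)))"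
      by (intro sum_ennreal[symmetric] state_nonneg[OF T] fc f0)
    also have "\<dots> \<le> (\<Sum>n. ennreal (T (f n)))"
      by (intro sum_le_suminf) auto
    finally have "ennreal (1 - e) + ennreal e \<le> (\<Sum>n. ennreal (T (f n))) + ennreal e"
      by (rule add_right_mono)
    \<comment> \<open>\<open>ennreal (1 - e)\<close> is cut off at 0 when \<open>1 < e\<close>,
      hence the case split.\<close>
    moreover have "1 \<le> ennreal (1 - e) + ennreal e"
    proof (cases "e \<le> 1")
      case True
      then show ?thesis using e by (simp flip: ennreal_plus)
    next
      case False
      then have "1 \<le> ennreal e" by (simp flip: ennreal_1 add: ennreal_leI)
      then show ?thesis by (simp add: add_increasing)
    qed
    ultimately show "1 \<le> (\<Sum>n. ennreal (T (f n))) + ennreal e"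
      by (rule order_trans[rotated])
  qed
qed

text \<open>Caratheodory's construction turns the outer measure into a Borel measure. Covers bound
  the measure of a set by \<open>T\<close> from one side only; this gives one inequality for
  functions with values between 0 and 1, and applying it to \<open>1 - g\<close> gives the
  reverse.\<close>

lemma riesz_representation_compact_metric:
  fixes T :: "('a::metric_space \<Rightarrow> real) \<Rightarrow> real"
  assumes K: "compact (UNIV :: 'a set)" and T: "T \<in> states"
  obtains \<mu> where "\<mu> \<in> borel_probs" "\<And>f. continuous_on UNIV f \<Longrightarrow> (\<integral>x. f x \<partial>\<mu>) = T f"
proof -
  let ?L = "lambda_system UNIV (Pow UNIV) (state_outer T)"
  define \<mu> where "\<mu> = measure_of UNIV (sets borel) (state_outer T)"
  have "measure_space UNIV ?L (state_outer T)"
    by (rule sigma_algebra.caratheodory_lemma[OF sigma_algebra_Pow outer_measure_space_state_outer[OF T]])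
  moreover have "sets borel \<subseteq> ?L"
  proof -
    have "sigma_algebra UNIV ?L"
      using \<open>measure_space UNIV ?L (state_outer T)\<close> by (simp add: measure_space_def)
    moreover have "Collect closed \<subseteq> ?L"
      using closed_in_lambda_system_state_outer[OF T] by auto
    ultimately show ?thesis
      by (simp add: borel_eq_closed sigma_algebra.sigma_sets_subset)
  qed
  ultimately have ms: "measure_space UNIV (sets borel) (state_outer T)"
    using measure_down sets.sigma_algebra_axioms[of borel] by (metis space_borel)
  have sets [simp]: "sets \<mu> = sets borel"
    using sets.sets_measure_of_eq[of borel] by (simp add: \<mu>_def)
  have em: "emeasure \<mu> A = state_outer T A" if "A \<in> sets borel" for A
  proof (rule emeasure_measure_of[OF \<mu>_def])
    show "positive (sets \<mu>) (state_outer T)" "countably_additive (sets \<mu>) (state_outer T)"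
      using ms by (simp_all add: measure_space_def)
  qed (use that in auto)
  have sp [simp]: "space \<mu> = UNIV"
    using sets_eq_imp_space_eq[OF sets] by simp
  interpret prob_space \<mu>
    using em[of UNIV] state_outer_UNIV[OF K T] by (intro prob_spaceI) simp
  have \<mu>: "\<mu> \<in> borel_probs"
    using prob_space_axioms by (simp add: mem_borel_probs_iff)
  have le_state: "measure \<mu> A \<le> T f"
    if "A \<in> sets borel" "continuous_on UNIV f" "\<And>x. 0 \<le> f x" "\<And>x. x \<in> A \<Longrightarrow> 1 \<le> f x" for A f
  proof -
    have "ennreal (measure \<mu> A) \<le> ennreal (T f)"
      using that em[of A] state_outer_le_single[OF T, of f A] by (simp add: emeasure_eq_measure)
    then show ?thesis
      using state_nonneg[OF T, of f] that by simp
  qed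
  have unit: "(\<integral>x. f x \<partial>\<mu>) \<le> T f" if fc: "continuous_on UNIV f" and f: "\<And>x. 0 \<le> f x" "\<And>x. f x \<le> 1" for f
  proof (rule field_le_epsilon)
    fix e :: real assume "0 < e"
    then obtain m where m: "1 / real (Suc m) < e"
      using nat_approx_posE by blast
    let ?N = "real (Suc m)"
    \<comment> \<open>The graph of \<open>f\<close> is cut into \<open>Suc m\<close> slices of equal
      height, each rescaled to height 1.\<close>
    define g where "g j x = max 0 (min 1 (?N * f x - real j))" for j x
    have gc: "continuous_on UNIV (g j)" for j
      unfolding g_def by (intro continuous_intros fc)
    have int: "integrable \<mu> f"
      using f by (intro integrable_continuous_bounded[OF \<mu> fc, of 1]) auto
    have meas: "{x. real j < ?N * f x} \<in> sets borel" for j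
      by (intro borel_open open_Collect_less continuous_intros fc)
    have "?N * (\<integral>x. f x \<partial>\<mu>) = (\<integral>x. ?N * f x \<partial>\<mu>)" by simp
    also have "\<dots> \<le> (\<integral>x. (\<Sum>j<Suc m. indicator {x. real j < ?N * f x} x) \<partial>\<mu>)"
    proof (rule integral_mono)
      fix x
      have "?N * f x = min (?N * f x) ?N" using f(2)[of x] by (simp add: min_def)
      also have "\<dots> = (\<Sum>j<Suc m. g j x)"
        unfolding g_def by (rule sum_clamp[symmetric]) (simp add: f)
      also have "\<dots> \<le> (\<Sum>j<Suc m. indicator {x. real j < ?N * f x} x)"
        by (intro sum_mono) (auto simp: g_def indicator_def)
      finally show "?N * f x \<le> (\<Sum>j<Suc m. indicator {x. real j < ?N * f x} x)" .
    qed (use int meas in \<open>auto simp: emeasure_eq_measure\<close>)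
    also have "\<dots> = (\<Sum>j<Suc m. measure \<mu> {x. real j < ?N * f x})"
      using meas by (subst Bochner_Integration.integral_sum) (auto simp: emeasure_eq_measure)
    \<comment> \<open>Index shift: where \<open>?N * f\<close> exceeds \<open>Suc j\<close>, the
      slice \<open>g j\<close> has already reached 1, so \<open>le_state\<close> applies to it. The
      level set of index 0 is left over; it costs at most 1, that is \<open>1 / ?N\<close> after
      division.\<close>
    also have "\<dots> \<le> 1 + (\<Sum>j<m. measure \<mu> {x. real (Suc j) < ?N * f x})"
      by (subst sum.lessThan_Suc_shift) (simp add: prob_le_1)
    also have "(\<Sum>j<m. measure \<mu> {x. real (Suc j) < ?N * f x}) \<le> (\<Sum>j<m. T (g j))"
    proof (intro sum_mono le_state gc meas)
      fix j x assume "x \<in> {x. real (Suc j) < ?N * f x}"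
      then have "real (Suc j) < ?N * f x" by simp
      then show "1 \<le> g j x" unfolding g_def by (simp add: max_def min_def)
    qed (simp add: g_def)
    also have "(\<Sum>j<m. T (g j)) \<le> (\<Sum>j<Suc m. T (g j))"
      using state_nonneg[OF T gc] by (simp add: g_def)
    also have "\<dots> = T (\<lambda>x. \<Sum>j<Suc m. g j x)"
      by (intro state_sum[OF T, symmetric] gc) auto
    also have "(\<lambda>x. \<Sum>j<Suc m. g j x) = (\<lambda>x. ?N * f x)"
    proof
      fix x
      have "(\<Sum>j<Suc m. g j x) = min (?N * f x) ?N"
        unfolding g_def by (rule sum_clamp) (simp add: f)
      then show "(\<Sum>j<Suc m. g j x) = ?N * f x" using f(2)[of x] by (simp add: min_def)
    qed
    also have "T (\<lambda>x. ?N * f x) = ?N * T f" by (rule state_cmult[OF T fc])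
    finally have "?N * (\<integral>x. f x \<partial>\<mu>) \<le> 1 + ?N * T f" by simp
    then have "(\<integral>x. f x \<partial>\<mu>) \<le> 1 / ?N + T f"
      by (simp add: field_simps)
    with m show "(\<integral>x. f x \<partial>\<mu>) \<le> T f + e" by simp
  qed
  have "(\<integral>x. f x \<partial>\<mu>) = T f" if fc: "continuous_on UNIV f" for f
  proof -
    obtain B where B: "0 < B" "\<And>x. \<bar>f x\<bar> \<le> B"
      using continuous_on_compact_bound[OF K fc] by metis
    have bd: "- B \<le> f x" "f x \<le> B" for x using B(2)[of x] by auto
    \<comment> \<open>The affine map taking the interval from \<open>- B\<close> to \<open>B\<close>
      onto the unit interval.\<close>
    define g where "g x = 1 / 2 + 1 / (2 * B) * f x" for x
    have gc: "continuous_on UNIV g"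
      unfolding g_def by (intro continuous_intros fc)
    have g: "0 \<le> g x" "g x \<le> 1" for x
      using bd[of x] B(1) by (simp_all add: g_def field_simps)
    have int: "integrable \<mu> f" "integrable \<mu> g"
      using integrable_continuous[OF K \<mu>] fc gc by auto
    have "(\<integral>x. 1 - g x \<partial>\<mu>) \<le> T (\<lambda>x. 1 - g x)"
      by (rule unit) (use g gc in \<open>auto intro!: continuous_intros\<close>)
    moreover have "T (\<lambda>x. 1 - g x) = 1 - T g"
      using state_diff[OF T _ gc, of "\<lambda>x. 1"] state_const[OF T, of 1] by simp
    ultimately have "T g \<le> (\<integral>x. g x \<partial>\<mu>)"
      using int prob_space by simp
    then have "(\<integral>x. g x \<partial>\<mu>) = T g"
      using unit[OF gc g] by simp
    moreover have "T g = T (\<lambda>x. 1 / 2) + T (\<lambda>x. 1 / (2 * B) * f x)"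
      unfolding g_def by (intro state_add[OF T] continuous_intros fc)
    then have "T g = 1 / 2 + 1 / (2 * B) * T f"
      by (simp only: state_cmult[OF T fc] state_const[OF T])
    moreover have "(\<integral>x. g x \<partial>\<mu>) = 1 / 2 + 1 / (2 * B) * (\<integral>x. f x \<partial>\<mu>)"
      unfolding g_def using int(1) prob_space by simp
    ultimately show ?thesis using B(1) by simp
  qed
  with \<mu> show ?thesis by (rule that)
qed

text \<open>Cutting off at discontinuous functions makes a measure determine a unique element of
  \<open>states\<close>, and keeps \<open>states\<close> compact in the product topology.\<close>

definition mean :: "'a::topological_space measure \<Rightarrow> ('a \<Rightarrow> real) \<Rightarrow> real" where
  "mean \<mu> f = (if continuous_on UNIV f then (\<integral>x. f x \<partial>\<mu>) else 0)"

lemma mean_continuous: "continuous_on UNIV f \<Longrightarrow> mean \<mu> f = (\<integral>x. f x \<partial>\<mu>)"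
  by (simp add: mean_def)

lemma mean_in_states:
  fixes \<mu> :: "'a::topological_space measure"
  assumes K: "compact (UNIV :: 'a set)" and \<mu>: "\<mu> \<in> borel_probs"
  shows "mean \<mu> \<in> states"
proof -
  interpret prob_space \<mu> using \<mu> by (simp add: mem_borel_probs_iff)
  show ?thesis
    using prob_space integrable_continuous[OF K \<mu>]
    by (auto simp: states_def mean_def continuous_on_add continuous_on_mult_left)
qed

lemma states_eq_mean:
  fixes T :: "('a::metric_space \<Rightarrow> real) \<Rightarrow> real"
  assumes K: "compact (UNIV :: 'a set)" and T: "T \<in> states"
  obtains \<mu> where "\<mu> \<in> borel_probs" "T = mean \<mu>"
proof -
  obtain \<mu> where \<mu>: "\<mu> \<in> borel_probs" "\<And>f. continuous_on UNIV f \<Longrightarrow> (\<integral>x. f x \<partial>\<mu>) = T f"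
    using riesz_representation_compact_metric[OF K T] by metis
  then have "T = mean \<mu>"
    using T by (auto simp: mean_def states_def fun_eq_iff)
  with \<mu>(1) show ?thesis by (rule that)
qed

section \<open>Compactness, minimax and lower semicontinuity\<close>

text \<open>The Banach-Alaoglu argument: positivity and normalisation confine each value
  \<open>T f\<close> to a compact interval, Tychonoff's theorem makes the product of these intervals
  compact, and each defining condition is closed because it involves finitely many
  coordinates.\<close>

lemma compact_states:
  assumes K: "compact (UNIV :: 'a::topological_space set)"
  shows "compact (states :: (('a \<Rightarrow> real) \<Rightarrow> real) set)"
proof -
  have "\<exists>B. continuous_on UNIV f \<longrightarrow> (\<forall>x. \<bar>f x\<bar> \<le> B)" for f :: "'a \<Rightarrow> real"
    using continuous_on_compact_bound[OF K] by metis
  then obtain B where B: "\<And>(f :: 'a \<Rightarrow> real) x. continuous_on UNIV f \<Longrightarrow> \<bar>f x\<bar> \<le> B f"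
    by metis
  define R where "R f = (if continuous_on UNIV f then {- B f..B f} else {0})" for f
  have "compactin (product_topology (\<lambda>_. euclidean) UNIV) (PiE UNIV R)"
    by (subst compactin_PiE) (auto simp: R_def)
  then have cpt: "compact (PiE UNIV R)"
    by (simp add: euclidean_product_topology)
  have sub: "states \<subseteq> PiE UNIV R"
  proof
    fix T :: "('a \<Rightarrow> real) \<Rightarrow> real" assume T: "T \<in> states"
    have "T f \<in> R f" for f
    proof (cases "continuous_on UNIV f")
      case True
      have "T (\<lambda>x. - B f) \<le> T f" "T f \<le> T (\<lambda>x. B f)"
        using B[OF True] by (auto intro!: state_mono[OF T] True simp: abs_le_iff minus_le_iff)
      then show ?thesis by (simp add: R_def True state_const[OF T])
    next
      case False
      then show ?thesis using T by (simp add: R_def states_def)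
    qed
    then show "T \<in> PiE UNIV R" by (simp add: PiE_def)
  qed
  have "closed (states :: (('a \<Rightarrow> real) \<Rightarrow> real) set)"
    unfolding states_def
    by (intro closed_Collect_conj closed_Collect_all closed_Collect_imp open_Collect_const
        closed_Collect_eq closed_Collect_le continuous_intros continuous_on_product_coordinates)
  then have "compact (PiE UNIV R \<inter> states)"
    using cpt by (rule compact_Int_closed[rotated])
  with sub show ?thesis by (simp add: Int_absorb1)
qed

text \<open>Adding one function at a time, separation is only ever needed in the plane.\<close>

lemma convexlike_weights:
  fixes f :: "'i \<Rightarrow> 'k \<Rightarrow> real"
  assumes "finite I" "I \<noteq> {}"
    and "\<And>x y u. x \<in> K \<Longrightarrow> y \<in> K \<Longrightarrow> 0 \<le> u \<Longrightarrow> u \<le> 1 \<Longrightarrow>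
      \<exists>z\<in>K. \<forall>i\<in>I. f i z \<le> (1 - u) * f i x + u * f i y"
    and "\<And>x. x \<in> K \<Longrightarrow> \<exists>i\<in>I. 0 < f i x"
  shows "\<exists>w. (\<forall>i\<in>I. 0 \<le> w i) \<and> sum w I = 1 \<and> (\<forall>x\<in>K. 0 \<le> (\<Sum>i\<in>I. w i * f i x))"
  using assms
proof (induction I arbitrary: K rule: finite_ne_induct)
  case (singleton i)
  then show ?case by (intro exI[of _ "\<lambda>_. 1"]) (auto intro: less_imp_le)
next
  case (insert j I)
  note cvx = insert.prems(1)
  \<comment> \<open>Where \<open>f j\<close> is positive the other functions need not be, so the
    induction hypothesis is used on the remaining points.\<close>
  define L where "L = {x\<in>K. f j x \<le> 0}"
  have "\<exists>w. (\<forall>i\<in>I. 0 \<le> w i) \<and> sum w I = 1 \<and> (\<forall>x\<in>L. 0 \<le> (\<Sum>i\<in>I. w i * f i x))"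
  proof (rule insert.IH)
    fix x y and u :: real
    assume xy: "x \<in> L" "y \<in> L" and u: "0 \<le> u" "u \<le> 1"
    then obtain z where z: "z \<in> K" "\<forall>i\<in>insert j I. f i z \<le> (1 - u) * f i x + u * f i y"
      using cvx[of x y u] by (auto simp: L_def)
    have "(1 - u) * f j x + u * f j y \<le> 0"
      using xy u by (auto simp: L_def intro!: add_nonpos_nonpos mult_nonneg_nonpos)
    then have "z \<in> L" using z by (force simp: L_def)
    then show "\<exists>z\<in>L. \<forall>i\<in>I. f i z \<le> (1 - u) * f i x + u * f i y"
      using z by auto
  next
    fix x assume "x \<in> L"
    then show "\<exists>i\<in>I. 0 < f i x"
      using insert.prems(2)[of x] by (auto simp: L_def)
  qed
  then obtain w where w: "\<And>i. i \<in> I \<Longrightarrow> 0 \<le> w i" "sum w I = 1"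
    "\<And>x. x \<in> L \<Longrightarrow> 0 \<le> (\<Sum>i\<in>I. w i * f i x)" by blast
  define g where "g x = (\<Sum>i\<in>I. w i * f i x)" for x
  have g_cvx: "g z \<le> (1 - u) * g x + u * g y"
    if "\<forall>i\<in>insert j I. f i z \<le> (1 - u) * f i x + u * f i y" for x y z u
  proof -
    have "g z \<le> (\<Sum>i\<in>I. w i * ((1 - u) * f i x + u * f i y))"
      unfolding g_def using that w(1) by (intro sum_mono mult_left_mono) auto
    also have "\<dots> = (1 - u) * g x + u * g y"
      by (simp add: g_def sum_distrib_left sum.distrib algebra_simps sum_subtractf)
    finally show ?thesis .
  qed
  have "\<exists>p q. 0 \<le> p \<and> 0 \<le> q \<and> 0 < p + q \<and> (\<forall>x\<in>K. 0 \<le> p * g x + q * f j x)"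
  proof (cases "K = {}")
    case True
    then show ?thesis by (intro exI[of _ 1]) auto
  next
    case False
    \<comment> \<open>\<open>D\<close> is the image of \<open>K\<close> under
      \<open>(g, f j)\<close> closed upwards, which turns the convexlike inequality into convexity.
      A point of \<open>E\<close> in \<open>D\<close> would come from a point of \<open>L\<close>
      with negative \<open>g\<close>, against the choice of \<open>w\<close>.\<close>
    define D where "D = {(a, b). \<exists>x\<in>K. g x \<le> a \<and> f j x \<le> b}"
    define E :: "(real \<times> real) set" where "E = {(a, b). a < 0 \<and> b \<le> 0}"
    have "convex D"
    proof (rule convexI)
      fix r s and u v :: real
      assume r: "r \<in> D" and s: "s \<in> D" and uv: "0 \<le> u" "0 \<le> v" "u + v = 1"
      obtain x where x: "x \<in> K" "g x \<le> fst r" "f j x \<le> snd r" using r by (auto simp: D_def)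
      obtain y where y: "y \<in> K" "g y \<le> fst s" "f j y \<le> snd s" using s by (auto simp: D_def)
      obtain z where z: "z \<in> K" "\<forall>i\<in>insert j I. f i z \<le> (1 - v) * f i x + v * f i y"
        using cvx[of x y v] x y uv by auto
      have u: "1 - v = u" using uv by simp
      have "g z \<le> u * g x + v * g y" using g_cvx[OF z(2)] u by simp
      also have "\<dots> \<le> u * fst r + v * fst s"
        using x y uv by (intro add_mono mult_left_mono) auto
      finally have 1: "g z \<le> u * fst r + v * fst s" .
      have "f j z \<le> u * f j x + v * f j y" using z(2) u by simp
      also have "\<dots> \<le> u * snd r + v * snd s"
        using x y uv by (intro add_mono mult_left_mono) auto
      finally have "f j z \<le> u * snd r + v * snd s" .
      with 1 z(1) show "u *\<^sub>R r + v *\<^sub>R s \<in> D"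
        by (auto simp: D_def case_prod_unfold)
    qed
    moreover have "E = {..<0} \<times> {..0}" by (auto simp: E_def)
    then have "convex E" by (simp add: convex_Times)
    moreover have "D \<noteq> {}" using False by (auto simp: D_def)
    moreover have "E \<noteq> {}" by (auto simp: E_def intro: exI[of _ "-1"])
    moreover have "E \<inter> D = {}"
    proof -
      have False if x: "x \<in> K" "g x < 0" "f j x \<le> 0" for x
        using w(3)[of x] x by (simp add: L_def g_def)
      then show ?thesis by (fastforce simp: D_def E_def)
    qed
    ultimately obtain n \<beta> where n: "n \<noteq> 0" "\<forall>x\<in>E. n \<bullet> x \<le> \<beta>" "\<forall>x\<in>D. \<beta> \<le> n \<bullet> x"
      using separating_hyperplane_sets[of E D] by metis
    obtain p q where pq: "n = (p, q)" by (cases n)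
    have E: "p * a + q * b \<le> \<beta>" if "a < 0" "b \<le> 0" for a b
      using n(2) that by (auto simp: E_def pq)
    have D: "\<beta> \<le> p * g x + q * f j x" if "x \<in> K" for x
      using n(3) that by (auto simp: D_def pq)
    \<comment> \<open>The origin is a limit of points of \<open>E\<close>, where the separating
      functional is at most \<open>\<beta>\<close>.\<close>
    have \<beta>: "0 \<le> \<beta>"
    proof (rule tendsto_upperbound)
      show "((\<lambda>a. p * a + q * 0) \<longlongrightarrow> 0) (at_left 0)"
        by (auto intro!: tendsto_eq_intros)
      show "\<forall>\<^sub>F a in at_left 0. p * a + q * 0 \<le> \<beta>"
        using E[of _ 0] by (auto simp: eventually_at_filter)
    qed simp
    \<comment> \<open>A negative \<open>p\<close> would give the functional the value
      \<open>\<beta> + 1\<close> on \<open>E\<close>. The same works for \<open>q\<close>, with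
      first coordinate \<open>-1\<close> because \<open>E\<close> excludes 0 there.\<close>
    have "0 \<le> p"
    proof (rule ccontr)
      assume "\<not> 0 \<le> p"
      then have "p * ((\<beta> + 1) / p) + q * 0 \<le> \<beta>"
        using \<beta> by (intro E) (auto simp: divide_neg_pos divide_pos_neg)
      then show False using \<open>\<not> 0 \<le> p\<close> by simp
    qed
    moreover have "0 \<le> q"
    proof (rule ccontr)
      assume "\<not> 0 \<le> q"
      then have "p * (-1) + q * ((\<beta> + p + 1) / q) \<le> \<beta>"
        using \<beta> \<open>0 \<le> p\<close> by (intro E) (auto simp: divide_le_0_iff)
      then show False using \<open>\<not> 0 \<le> q\<close> by simp
    qed
    moreover have "0 < p + q"
      using n(1) pq \<open>0 \<le> p\<close> \<open>0 \<le> q\<close> by (auto simp: zero_prod_def)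
    moreover have "\<forall>x\<in>K. 0 \<le> p * g x + q * f j x"
      using D \<beta> by force
    ultimately show ?thesis by blast
  qed
  then obtain p q where pq: "0 \<le> p" "0 \<le> q" "0 < p + q"
    "\<And>x. x \<in> K \<Longrightarrow> 0 \<le> p * g x + q * f j x" by blast
  \<comment> \<open>The old weights are scaled by \<open>p\<close>, the new function gets
    \<open>q\<close>, and all are normalised.\<close>
  define v where "v i = (if i = j then q else p * w i) / (p + q)" for i
  have sum_I: "(\<Sum>i\<in>I. v i * h i) = p / (p + q) * (\<Sum>i\<in>I. w i * h i)" for h
  proof -
    have "(\<Sum>i\<in>I. v i * h i) = (\<Sum>i\<in>I. p / (p + q) * (w i * h i))"
      using insert.hyps by (intro sum.cong) (auto simp: v_def)
    then show ?thesis by (simp add: sum_distrib_left)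
  qed
  have "sum v (insert j I) = 1"
    using sum_I[of "\<lambda>_. 1"] insert.hyps w(2) pq(3)
    by (simp add: v_def field_simps flip: add_divide_distrib)
  moreover have "0 \<le> (\<Sum>i\<in>insert j I. v i * f i x)" if "x \<in> K" for x
  proof -
    have "(\<Sum>i\<in>insert j I. v i * f i x) = (p * g x + q * f j x) / (p + q)"
      using sum_I[of "\<lambda>i. f i x"] insert.hyps by (simp add: v_def g_def add_divide_distrib)
    then show ?thesis using pq that by simp
  qed
  moreover have "\<forall>i\<in>insert j I. 0 \<le> v i"
    using pq w(1) by (auto simp: v_def)
  ultimately show ?case by blast
qed

section \<open>Lower semicontinuous functions and continuous minorants\<close>

text \<open>Lipschitz envelopes \<open>INF y. f y + real n * dist x y\<close>. They converge since
  near \<open>x\<close> lower semicontinuity keeps \<open>f\<close> large, while far from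
  \<open>x\<close> the penalty is large and \<open>f\<close> is nonnegative.\<close>

lemma lower_semicontinuous_approx:
  fixes f :: "'a::metric_space \<Rightarrow> real"
  assumes lsc: "lower_semicontinuous f" and nonneg: "\<And>x. 0 \<le> f x"
  obtains F where "\<And>n. continuous_on UNIV (F n)" "\<And>n x. 0 \<le> F n x" "\<And>n x. F n x \<le> f x"
    "\<And>n x. F n x \<le> F (Suc n) x" "\<And>x. (\<lambda>n. F n x) \<longlonglongrightarrow> f x"
proof -
  define F where "F n x = (INF y. f y + real n * dist x y)" for n :: nat and x
  have bdd: "bdd_below (range (\<lambda>y. f y + real n * dist x y))" for n x
    by (rule bdd_belowI[of _ 0]) (auto simp: nonneg)
  have lower: "F n x \<le> f y + real n * dist x y" for n x y
    unfolding F_def by (rule cINF_lower[OF bdd]) simp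
  have greatest: "t \<le> F n x" if "\<And>y. t \<le> f y + real n * dist x y" for t n x
    unfolding F_def using that by (intro cINF_greatest) auto
  have lip: "F n x \<le> F n z + real n * dist x z" for n x z
  proof -
    have "F n x - real n * dist x z \<le> F n z"
    proof (rule greatest)
      fix y
      have "real n * dist x y \<le> real n * (dist x z + dist z y)"
        by (intro mult_left_mono dist_triangle) simp
      then show "F n x - real n * dist x z \<le> f y + real n * dist z y"
        using lower[of n x y] by (simp add: algebra_simps)
    qed
    then show ?thesis by simp
  qed
  have "continuous_on UNIV (F n)" for n
  proof (rule lipschitz_on_continuous_on, rule lipschitz_onI)
    fix x y
    show "dist (F n x) (F n y) \<le> real n * dist x y"
      using lip[of n x y] lip[of n y x] by (simp add: dist_real_def dist_commute)
  qed simp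
  moreover have "0 \<le> F n x" for n x
    by (rule greatest) (simp add: nonneg)
  moreover have le: "F n x \<le> f x" for n x
    using lower[of n x x] by simp
  moreover have "F n x \<le> F (Suc n) x" for n x
  proof (rule greatest)
    fix y
    show "F n x \<le> f y + real (Suc n) * dist x y"
      using lower[of n x y] zero_le_dist[of x y] by (simp add: algebra_simps del: zero_le_dist)
  qed
  moreover have "(\<lambda>n. F n x) \<longlonglongrightarrow> f x" for x
  proof (rule order_tendstoI)
    fix t assume "t < f x"
    then obtain s where s: "t < s" "s < f x" using dense by blast
    then obtain d where d: "0 < d" "\<And>y. dist y x < d \<Longrightarrow> s < f y"
      using lsc unfolding lower_semicontinuous_def eventually_nhds_metric by meson
    \<comment> \<open>From this \<open>N\<close> on, the penalty at distance \<open>d\<close> alone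
      exceeds \<open>s\<close>.\<close>
    obtain N :: nat where N: "s / d < real N" using reals_Archimedean2 by blast
    have "s \<le> F n x" if "N \<le> n" for n
    proof (rule greatest)
      fix y
      show "s \<le> f y + real n * dist x y"
      proof (cases "dist y x < d")
        case True
        then show ?thesis using d(2)[of y] by (simp add: add_increasing2)
      next
        case False
        have "s \<le> real N * d" using N d(1) by (simp add: field_simps)
        also have "\<dots> \<le> real n * dist x y"
          using False that d(1) by (intro mult_mono) (auto simp: dist_commute)
        finally show ?thesis using nonneg[of y] by simp
      qed
    qed
    with s(1) show "\<forall>\<^sub>F n in sequentially. t < F n x"
      by (auto simp: eventually_sequentially intro!: exI[of _ N] intro: less_le_trans)
  next
    fix a assume "f x < a"
    then show "\<forall>\<^sub>F n in sequentially. F n x < a"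
      using le le_less_trans by (intro always_eventually) blast
  qed
  ultimately show ?thesis by (rule that)
qed

text \<open>Monotone convergence along the Lipschitz envelopes reduces the cost to continuous
  functions, on which states carry information.\<close>

lemma nn_integral_le_of_continuous_minorants:
  fixes f :: "'a::metric_space \<Rightarrow> real"
  assumes K: "compact (UNIV :: 'a set)" and \<pi>: "\<pi> \<in> borel_probs"
    and f: "lower_semicontinuous f" "\<And>x. 0 \<le> f x"
    and le: "\<And>h. continuous_on UNIV h \<Longrightarrow> (\<And>x. h x \<le> f x) \<Longrightarrow> (\<integral>x. h x \<partial>\<pi>) \<le> t"
  shows "(\<integral>\<^sup>+x. ennreal (f x) \<partial>\<pi>) \<le> ennreal t"
proof -
  obtain F where F: "\<And>n. continuous_on UNIV (F n)" "\<And>n x. 0 \<le> F n x" "\<And>n x. F n x \<le> f x"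
    "\<And>n x. F n x \<le> F (Suc n) x" "\<And>x. (\<lambda>n. F n x) \<longlonglongrightarrow> f x"
    using lower_semicontinuous_approx[OF f] by blast
  have inc: "incseq (\<lambda>n x. ennreal (F n x))"
    by (intro incseq_SucI) (auto simp: le_fun_def intro!: ennreal_leI F)
  have "ennreal (f x) = (SUP n. ennreal (F n x))" for x
  proof (rule LIMSEQ_unique)
    show "(\<lambda>n. ennreal (F n x)) \<longlonglongrightarrow> ennreal (f x)"
      by (intro tendsto_ennrealI F)
    show "(\<lambda>n. ennreal (F n x)) \<longlonglongrightarrow> (SUP n. ennreal (F n x))"
      using inc by (intro LIMSEQ_SUP) (auto simp: incseq_def le_fun_def)
  qed
  then have "(\<integral>\<^sup>+x. ennreal (f x) \<partial>\<pi>) = (\<integral>\<^sup>+x. (SUP n. ennreal (F n x)) \<partial>\<pi>)"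
    by simp
  also have "\<dots> = (SUP n. \<integral>\<^sup>+x. ennreal (F n x) \<partial>\<pi>)"
    using measurable_continuous_borel_probs[OF \<pi> F(1)] inc
    by (intro nn_integral_monotone_convergence_SUP) auto
  also have "\<dots> \<le> ennreal t"
  proof (rule SUP_least)
    fix n
    have "(\<integral>\<^sup>+x. ennreal (F n x) \<partial>\<pi>) = ennreal (\<integral>x. F n x \<partial>\<pi>)"
      using integrable_continuous[OF K \<pi> F(1)] F(2) by (intro nn_integral_eq_integral) auto
    also have "\<dots> \<le> ennreal t"
      using F by (intro ennreal_leI le) auto
    finally show "(\<integral>\<^sup>+x. ennreal (F n x) \<partial>\<pi>) \<le> ennreal t" .
  qed
  finally show ?thesis .
qed

text \<open>Since \<open>h\<close> may be negative, its positive part is compared with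
  \<open>f\<close>.\<close>

lemma integral_le_nn_integral_of_minorant:
  fixes f h :: "'a::topological_space \<Rightarrow> real"
  assumes K: "compact (UNIV :: 'a set)" and \<pi>: "\<pi> \<in> borel_probs"
    and h: "continuous_on UNIV h" "\<And>x. h x \<le> f x" and f: "\<And>x. 0 \<le> f x"
  shows "ennreal (\<integral>x. h x \<partial>\<pi>) \<le> (\<integral>\<^sup>+x. ennreal (f x) \<partial>\<pi>)"
proof -
  let ?g = "\<lambda>x. max 0 (h x)"
  have int: "integrable \<pi> h" "integrable \<pi> ?g"
    by (intro integrable_continuous[OF K \<pi>] continuous_intros h)+
  have "ennreal (\<integral>x. h x \<partial>\<pi>) \<le> ennreal (\<integral>x. ?g x \<partial>\<pi>)"
    using int by (intro ennreal_leI integral_mono) auto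
  also have "\<dots> = (\<integral>\<^sup>+x. ennreal (?g x) \<partial>\<pi>)"
    using int(2) by (intro nn_integral_eq_integral[symmetric]) auto
  also have "\<dots> \<le> (\<integral>\<^sup>+x. ennreal (f x) \<partial>\<pi>)"
    by (intro nn_integral_mono ennreal_leI max.boundedI f h)
  finally show ?thesis .
qed

section \<open>Kantorovich duality and the robust problem\<close>

text \<open>The Dirac functional at \<open>z\<close>. At a minimiser of the integrand of the
  Lagrangian it is the optimal unconstrained \<open>\<pi>\<close>.\<close>

lemma state_at_point:
  "(\<lambda>f. if continuous_on UNIV f then f z else 0) \<in> states"
  by (auto simp: states_def continuous_on_add continuous_on_mult_left)

lemma states_mix:
  assumes "S \<in> states" "T \<in> states" "0 \<le> u" "u \<le> 1"
  shows "(\<lambda>f. (1 - u) * S f + u * T f) \<in> states"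
  using assms
  by (auto simp: states_def intro!: add_nonneg_nonneg mult_nonneg_nonneg) (simp_all add: algebra_simps)

lemma distr_eqI:
  fixes \<pi> :: "'a::topological_space measure" and g :: "'a \<Rightarrow> 'b::metric_space"
  assumes \<pi>: "\<pi> \<in> borel_probs" and \<mu>: "\<mu> \<in> borel_probs" and g: "continuous_on UNIV g"
    and eq: "\<And>f :: 'b \<Rightarrow> real. continuous_on UNIV f \<Longrightarrow> (\<integral>z. f (g z) \<partial>\<pi>) = (\<integral>x. f x \<partial>\<mu>)"
  shows "distr \<pi> borel g = \<mu>"
proof (rule borel_probs_eqI)
  interpret prob_space \<pi> using \<pi> by (simp add: mem_borel_probs_iff)
  have m: "g \<in> borel_measurable \<pi>" by (rule measurable_continuous_borel_probs[OF \<pi> g])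
  show "distr \<pi> borel g \<in> borel_probs"
    using prob_space_distr[OF m] by (simp add: mem_borel_probs_iff)
  fix f :: "'b \<Rightarrow> real" assume f: "continuous_on UNIV f"
  then have "f \<in> borel_measurable borel" by (rule borel_measurable_continuous_onI)
  then show "(\<integral>x. f x \<partial>distr \<pi> borel g) = (\<integral>x. f x \<partial>\<mu>)"
    using integral_distr[OF m, of f] eq[OF f] by simp
qed (rule \<mu>)

lemma continuous_on_diff_marginals:
  fixes h :: "'a::topological_space \<times> 'b::topological_space \<Rightarrow> real"
  assumes "continuous_on UNIV h" "continuous_on UNIV \<phi>" "continuous_on UNIV \<beta>"
  shows "continuous_on UNIV (\<lambda>z. h z - \<phi> (fst z) - \<beta> (snd z))"
  by (intro continuous_on_diff assms(1)
      continuous_on_compose2[OF assms(2) continuous_on_fst[OF continuous_on_id]]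
      continuous_on_compose2[OF assms(3) continuous_on_snd[OF continuous_on_id]] subset_UNIV)

text \<open>A multiplier may be scaled by any real factor, so a bound uniform over multipliers
  forces its constraint to hold with equality; this yields the marginals.\<close>

lemma zero_of_all_mult_le:
  fixes d :: real
  assumes "\<And>s. s * d \<le> t"
  shows "d = 0"
  using assms[of "(t + 1) / d"] by (cases "d = 0") auto

text \<open>
  Marginal constraints and the minorants of the cost are dualised simultaneously: if the saddle
  inequality holds for every multiplier, then finitely many multipliers always admit a common
  primal point (otherwise a convex combination of them would violate the hypothesis), and
  compactness gives one primal point for all multipliers.
\<close>

lemma coupling_of_dual_bound:
  fixes c' :: "'x::metric_space \<times> 'y::metric_space \<Rightarrow> real"
  assumes KX: "compact (UNIV :: 'x set)" and KY: "compact (UNIV :: 'y set)"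
    and c': "\<And>z. 0 \<le> c' z" "lower_semicontinuous c'"
    and \<nu>: "\<nu> \<in> borel_probs"
    and Q: "Q \<subseteq> states" "compact Q"
    and Q_mix: "\<And>S S' u. S \<in> Q \<Longrightarrow> S' \<in> Q \<Longrightarrow> 0 \<le> u \<Longrightarrow> u \<le> 1 \<Longrightarrow> (\<lambda>f. (1 - u) * S f + u * S' f) \<in> Q"
    and bound: "\<And>\<alpha> \<beta>. (\<alpha>, \<beta>) \<in> dual_feasible c' \<Longrightarrow> \<exists>S\<in>Q. S \<alpha> + (\<integral>y. \<beta> y \<partial>\<nu>) \<le> t"
  shows "\<exists>\<mu>\<in>borel_probs. mean \<mu> \<in> Q \<and> (\<exists>\<pi>\<in>couplings \<mu> \<nu>. transport_cost c' \<pi> \<le> ennreal t)"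
proof -
  have KXY: "compact (UNIV :: ('x \<times> 'y) set)"
    using compact_Times[OF KX KY] by simp
  \<comment> \<open>An index is a slack, a continuous minorant of the cost and a multiplier for each
    marginal. The slack is strictly positive because the weights obtained below give only a weak
    inequality, which it turns into a contradiction.\<close>
  define Idx where "Idx = {(e :: real, h, \<phi> :: 'x \<Rightarrow> real, \<beta> :: 'y \<Rightarrow> real).
    0 < e \<and> continuous_on UNIV h \<and> (\<forall>z. h z \<le> c' z) \<and> continuous_on UNIV \<phi> \<and> continuous_on UNIV \<beta>}"
  define ie :: "real \<times> ('x \<times> 'y \<Rightarrow> real) \<times> ('x \<Rightarrow> real) \<times> ('y \<Rightarrow> real) \<Rightarrow> real" where "ie = fst"
  define ih :: "real \<times> ('x \<times> 'y \<Rightarrow> real) \<times> ('x \<Rightarrow> real) \<times> ('y \<Rightarrow> real) \<Rightarrow> _" where "ih i = fst (snd i)" for i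
  define ip :: "real \<times> ('x \<times> 'y \<Rightarrow> real) \<times> ('x \<Rightarrow> real) \<times> ('y \<Rightarrow> real) \<Rightarrow> _" where "ip i = fst (snd (snd i))" for i
  define ib :: "real \<times> ('x \<times> 'y \<Rightarrow> real) \<times> ('x \<Rightarrow> real) \<times> ('y \<Rightarrow> real) \<Rightarrow> _" where "ib i = snd (snd (snd i))" for i
  have Idx: "0 < ie i" "continuous_on UNIV (ih i)" "ih i z \<le> c' z"
    "continuous_on UNIV (ip i)" "continuous_on UNIV (ib i)" if "i \<in> Idx" for i z
    using that by (cases z; auto simp: Idx_def ie_def ih_def ip_def ib_def)+
  define G where "G i p = snd p (\<lambda>z. ih i z - ip i (fst z) - ib i (snd z)) + fst p (ip i)
    + (\<integral>y. ib i y \<partial>\<nu>) - t - ie i" for i and p :: "(('x \<Rightarrow> real) \<Rightarrow> real) \<times> (('x \<times> 'y \<Rightarrow> real) \<Rightarrow> real)"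
  define K where "K = Q \<times> (states :: (('x \<times> 'y \<Rightarrow> real) \<Rightarrow> real) set)"
  have "compact K"
    unfolding K_def by (intro compact_Times Q compact_states KXY)
  moreover have "closed {p. G i p \<le> 0}" for i
    unfolding G_def
    by (intro closed_Collect_le continuous_on_add continuous_on_diff continuous_on_const
        continuous_on_product_then_coordinatewise[OF continuous_on_fst[OF continuous_on_id]]
        continuous_on_product_then_coordinatewise[OF continuous_on_snd[OF continuous_on_id]])
  moreover have "K \<inter> (\<Inter>i\<in>I. {p. G i p \<le> 0}) \<noteq> {}" if I: "finite I" "I \<subseteq> Idx" for I
  proof (cases "I = {}")
    \<comment> \<open>Only nonemptiness of \<open>K\<close> is at stake. The zero pair is feasible
      since \<open>c'\<close> is nonnegative, and \<open>bound\<close> then provides a point of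
      \<open>Q\<close>.\<close>
    case True
    have "(\<lambda>x. 0, \<lambda>y. 0) \<in> dual_feasible c'"
      using c' by (auto simp: dual_feasible_def)
    then have "Q \<noteq> {}" using bound by blast
    then show ?thesis using True state_at_point by (auto simp: K_def)
  next
    case False
    show ?thesis
    proof (rule ccontr)
      assume "\<not> ?thesis"
      then have pos: "\<exists>i\<in>I. 0 < G i p" if "p \<in> K" for p
        using that by (force simp: not_le)
      have "\<exists>w. (\<forall>i\<in>I. 0 \<le> w i) \<and> sum w I = 1 \<and> (\<forall>p\<in>K. 0 \<le> (\<Sum>i\<in>I. w i * G i p))"
      proof (rule convexlike_weights[OF I(1) False _ pos])
        fix p q and u :: real
        assume "p \<in> K" "q \<in> K" "0 \<le> u" "u \<le> 1"
        \<comment> \<open>\<open>G i\<close> is affine in the pair of functionals, so the mixture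
          satisfies the convexlike inequality with equality.\<close>
        then have "(\<lambda>f. (1 - u) * fst p f + u * fst q f, \<lambda>f. (1 - u) * snd p f + u * snd q f) \<in> K"
          using Q_mix states_mix by (auto simp: K_def)
        then show "\<exists>r\<in>K. \<forall>i\<in>I. G i r \<le> (1 - u) * G i p + u * G i q"
          by (rule rev_bexI) (simp add: G_def algebra_simps)
      qed
      then obtain w where w: "\<And>i. i \<in> I \<Longrightarrow> 0 \<le> w i" "sum w I = 1"
        "\<And>p. p \<in> K \<Longrightarrow> 0 \<le> (\<Sum>i\<in>I. w i * G i p)" by blast
      \<comment> \<open>The averaged multipliers are again admissible: a convex combination of
        minorants of \<open>c'\<close> is a minorant.\<close>
      define h where "h z = (\<Sum>i\<in>I. w i * ih i z)" for z
      define \<phi> where "\<phi> x = (\<Sum>i\<in>I. w i * ip i x)" for x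
      define \<beta> where "\<beta> y = (\<Sum>i\<in>I. w i * ib i y)" for y
      define e where "e = (\<Sum>i\<in>I. w i * ie i)"
      have cont: "continuous_on UNIV h" "continuous_on UNIV \<phi>" "continuous_on UNIV \<beta>"
        using I(2) Idx unfolding h_def \<phi>_def \<beta>_def by (auto intro!: continuous_intros)
      have e: "0 < e"
      proof -
        obtain j where j: "j \<in> I" "0 < w j"
          using w(1,2) by (metis less_eq_real_def sum.neutral zero_neq_one)
        have pos: "0 < ie i" if "i \<in> I" for i
          using Idx(1) I(2) that by blast
        show ?thesis
          unfolding e_def using j pos[OF j(1)] w(1) less_imp_le[OF pos]
          by (intro sum_pos2[OF I(1) j(1)] mult_pos_pos mult_nonneg_nonneg) auto
      qed
      have h_le: "h z \<le> c' z" for z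
      proof -
        have "h z \<le> (\<Sum>i\<in>I. w i * c' z)"
          unfolding h_def by (intro sum_mono mult_left_mono w(1) Idx(3)) (use I(2) in blast)+
        then show ?thesis using w(2) by (simp flip: sum_distrib_right)
      qed
      have "continuous_on UNIV (\<lambda>z. h z - \<phi> (fst z) - \<beta> (snd z))"
        by (intro continuous_on_diff_marginals cont)
      then obtain z0 where z0: "\<And>z. h z0 - \<phi> (fst z0) - \<beta> (snd z0) \<le> h z - \<phi> (fst z) - \<beta> (snd z)"
        using continuous_attains_inf[OF KXY] by blast
      \<comment> \<open>The largest constant for which \<open>\<phi> x + m + \<beta> y\<close> stays
        below \<open>h\<close>, hence below \<open>c'\<close>.\<close>
      define m where "m = h z0 - \<phi> (fst z0) - \<beta> (snd z0)"
      have "(\<lambda>x. \<phi> x + m, \<beta>) \<in> dual_feasible c'"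
        unfolding dual_feasible_def
      proof (clarify, intro conjI allI)
        fix x y
        show "\<phi> x + m + \<beta> y \<le> c' (x, y)"
          using z0[of "(x, y)"] h_le[of "(x, y)"] by (simp add: m_def)
      qed (intro continuous_intros cont)+
      then obtain S where S: "S \<in> Q" "S (\<lambda>x. \<phi> x + m) + (\<integral>y. \<beta> y \<partial>\<nu>) \<le> t"
        using bound by blast
      have S_state: "S \<in> states" using S(1) Q(1) by auto
      \<comment> \<open>The point mass at \<open>z0\<close> attains the minimum over
        \<open>\<pi>\<close>. At \<open>(S, T0)\<close> the averaged \<open>G\<close> is therefore
        the value of the pair \<open>(\<phi> + m, \<beta>)\<close> at \<open>S\<close>, less
        \<open>t\<close> and \<open>e\<close>, so it is at most \<open>- e\<close>.\<close>
      define T0 :: "('x \<times> 'y \<Rightarrow> real) \<Rightarrow> real"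
        where "T0 f = (if continuous_on UNIV f then f z0 else 0)" for f
      have "(S, T0) \<in> K"
        using S(1) state_at_point[of z0] by (simp add: K_def T0_def[abs_def])
      then have "0 \<le> (\<Sum>i\<in>I. w i * G i (S, T0))" by (rule w(3))
      also have "\<dots> = (\<Sum>i\<in>I. w i * (ih i z0 - ip i (fst z0) - ib i (snd z0))
          + w i * S (ip i) + w i * (\<integral>y. ib i y \<partial>\<nu>) - w i * t - w i * ie i)"
      proof (intro sum.cong refl)
        fix i assume "i \<in> I"
        then have i: "i \<in> Idx" using I(2) by auto
        have "continuous_on UNIV (\<lambda>z. ih i z - ip i (fst z) - ib i (snd z))"
          by (intro continuous_on_diff_marginals Idx i)
        then show "w i * G i (S, T0) = w i * (ih i z0 - ip i (fst z0) - ib i (snd z0))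
          + w i * S (ip i) + w i * (\<integral>y. ib i y \<partial>\<nu>) - w i * t - w i * ie i"
          by (simp add: G_def T0_def algebra_simps)
      qed
      also have "\<dots> = m + (\<Sum>i\<in>I. w i * S (ip i)) + (\<Sum>i\<in>I. w i * (\<integral>y. ib i y \<partial>\<nu>)) - t - e"
        using w(2) by (simp add: m_def h_def \<phi>_def \<beta>_def e_def sum.distrib sum_subtractf
            right_diff_distrib flip: sum_distrib_right)
      also have "(\<Sum>i\<in>I. w i * S (ip i)) = S \<phi>"
      proof -
        have "S \<phi> = (\<Sum>i\<in>I. S (\<lambda>x. w i * ip i x))"
          unfolding \<phi>_def using I Idx by (intro state_sum[OF S_state]) (auto intro!: continuous_intros)
        also have "\<dots> = (\<Sum>i\<in>I. w i * S (ip i))"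
          using I Idx by (intro sum.cong state_cmult[OF S_state]) auto
        finally show ?thesis by simp
      qed
      also have "(\<Sum>i\<in>I. w i * (\<integral>y. ib i y \<partial>\<nu>)) = (\<integral>y. \<beta> y \<partial>\<nu>)"
        unfolding \<beta>_def using I Idx(5) integrable_continuous[OF KY \<nu>]
        by (subst Bochner_Integration.integral_sum) auto
      also have "m + S \<phi> = S (\<lambda>x. \<phi> x + m)"
        using state_add[OF S_state cont(2), of "\<lambda>x. m"] state_const[OF S_state, of m] by simp
      finally show False using S(2) e by simp
    qed
  qed
  ultimately have "K \<inter> (\<Inter>i\<in>Idx. {p. G i p \<le> 0}) \<noteq> {}"
    by (rule compact_imp_fip_image)
  then obtain S T where ST: "S \<in> Q" "T \<in> states" and le: "\<And>i. i \<in> Idx \<Longrightarrow> G i (S, T) \<le> 0"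
    by (auto simp: K_def)
  obtain \<mu> where \<mu>: "\<mu> \<in> borel_probs" "S = mean \<mu>"
    using states_eq_mean[OF KX] ST(1) Q(1) by blast
  obtain \<pi> where \<pi>: "\<pi> \<in> borel_probs" "T = mean \<pi>"
    using states_eq_mean[OF KXY ST(2)] by blast
  \<comment> \<open>The slack was arbitrary and disappears here.\<close>
  have ineq: "(\<integral>z. h z - \<phi> (fst z) - \<beta> (snd z) \<partial>\<pi>) + (\<integral>x. \<phi> x \<partial>\<mu>) + (\<integral>y. \<beta> y \<partial>\<nu>) \<le> t"
    if c: "continuous_on UNIV h" "continuous_on UNIV \<phi>" "continuous_on UNIV \<beta>" and h: "\<And>z. h z \<le> c' z"
    for h \<phi> \<beta>
  proof (rule field_le_epsilon)
    fix e :: real assume "0 < e"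
    then have "(e, h, \<phi>, \<beta>) \<in> Idx" using c h by (simp add: Idx_def)
    moreover have "continuous_on UNIV (\<lambda>z. h z - \<phi> (fst z) - \<beta> (snd z))"
      by (intro continuous_on_diff_marginals c)
    ultimately show "(\<integral>z. h z - \<phi> (fst z) - \<beta> (snd z) \<partial>\<pi>) + (\<integral>x. \<phi> x \<partial>\<mu>) + (\<integral>y. \<beta> y \<partial>\<nu>) \<le> t + e"
      using le[of "(e, h, \<phi>, \<beta>)"] c
      by (simp add: G_def ie_def ih_def ip_def ib_def \<mu>(2) \<pi>(2) mean_continuous)
  qed
  have "distr \<pi> borel fst = \<mu>"
  proof (rule distr_eqI[OF \<pi>(1) \<mu>(1)])
    fix f :: "'x \<Rightarrow> real" assume f: "continuous_on UNIV f"
    \<comment> \<open>The minorant 0 of the cost leaves only the multiplier, scaled by an arbitrary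
      \<open>s\<close>.\<close>
    have "s * ((\<integral>x. f x \<partial>\<mu>) - (\<integral>z. f (fst z) \<partial>\<pi>)) \<le> t" for s
      using ineq[of "\<lambda>z. 0" "\<lambda>x. s * f x" "\<lambda>y. 0"] f c'(1) by (simp add: algebra_simps continuous_on_mult_left)
    then show "(\<integral>z. f (fst z) \<partial>\<pi>) = (\<integral>x. f x \<partial>\<mu>)"
      using zero_of_all_mult_le by fastforce
  qed (intro continuous_intros)
  moreover have "distr \<pi> borel snd = \<nu>"
  proof (rule distr_eqI[OF \<pi>(1) \<nu>])
    fix f :: "'y \<Rightarrow> real" assume f: "continuous_on UNIV f"
    have "s * ((\<integral>x. f x \<partial>\<nu>) - (\<integral>z. f (snd z) \<partial>\<pi>)) \<le> t" for s
      using ineq[of "\<lambda>z. 0" "\<lambda>x. 0" "\<lambda>y. s * f y"] f c'(1) by (simp add: algebra_simps continuous_on_mult_left)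
    then show "(\<integral>z. f (snd z) \<partial>\<pi>) = (\<integral>x. f x \<partial>\<nu>)"
      using zero_of_all_mult_le by fastforce
  qed (intro continuous_intros)
  ultimately have "\<pi> \<in> couplings \<mu> \<nu>"
    using \<pi>(1) by (simp add: couplings_def)
  moreover have "transport_cost c' \<pi> \<le> ennreal t"
    unfolding transport_cost_def
  proof (rule nn_integral_le_of_continuous_minorants[OF KXY \<pi>(1) c'(2,1)])
    fix h :: "'x \<times> 'y \<Rightarrow> real" assume "continuous_on UNIV h" "\<And>z. h z \<le> c' z"
    then show "(\<integral>z. h z \<partial>\<pi>) \<le> t"
      using ineq[of h "\<lambda>x. 0" "\<lambda>y. 0"] by simp
  qed
  ultimately show ?thesis
    using \<mu> ST(1) by blast
qed

section \<open>Kantorovich duality with attainment\<close>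

lemma dual_feasibleD:
  assumes "(\<alpha>, \<beta>) \<in> dual_feasible c'"
  shows "continuous_on UNIV \<alpha>" "continuous_on UNIV \<beta>" "\<alpha> x + \<beta> y \<le> c' (x, y)"
  using assms by (auto simp: dual_feasible_def)

lemma couplings_integral:
  fixes \<mu> :: "'x::topological_space measure" and \<nu> :: "'y::topological_space measure"
    and f :: "'x \<Rightarrow> real" and g :: "'y \<Rightarrow> real"
  assumes \<pi>: "\<pi> \<in> couplings \<mu> \<nu>"
  shows "continuous_on UNIV f \<Longrightarrow> (\<integral>z. f (fst z) \<partial>\<pi>) = (\<integral>x. f x \<partial>\<mu>)"
    and "continuous_on UNIV g \<Longrightarrow> (\<integral>z. g (snd z) \<partial>\<pi>) = (\<integral>y. g y \<partial>\<nu>)"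
proof -
  have m: "fst \<in> borel_measurable \<pi>" "snd \<in> borel_measurable \<pi>"
    using \<pi> by (auto simp: couplings_def intro!: measurable_continuous_borel_probs continuous_intros)
  show "(\<integral>z. f (fst z) \<partial>\<pi>) = (\<integral>x. f x \<partial>\<mu>)" if "continuous_on UNIV f"
    using integral_distr[OF m(1) borel_measurable_continuous_onI[OF that]] \<pi>
    by (simp add: couplings_def)
  show "(\<integral>z. g (snd z) \<partial>\<pi>) = (\<integral>y. g y \<partial>\<nu>)" if "continuous_on UNIV g"
    using integral_distr[OF m(2) borel_measurable_continuous_onI[OF that]] \<pi>
    by (simp add: couplings_def)
qed

context
  fixes c' :: "'x::metric_space \<times> 'y::metric_space \<Rightarrow> real"
  assumes KX: "compact (UNIV :: 'x set)" and KY: "compact (UNIV :: 'y set)"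
    and c': "\<And>z. 0 \<le> c' z" "lower_semicontinuous c'"
begin

text \<open>Weak duality: integrate the feasibility inequality against a coupling, whose marginals
  split the left side.\<close>

lemma dual_value_le_ot_cost:
  assumes "(\<alpha>, \<beta>) \<in> dual_feasible c'"
  shows "ennreal (dual_value \<mu> \<nu> \<alpha> \<beta>) \<le> ot_cost c' \<mu> \<nu>"
  unfolding ot_cost_def
proof (rule INF_greatest)
  fix \<pi> assume \<pi>: "\<pi> \<in> couplings \<mu> \<nu>"
  have \<pi>': "\<pi> \<in> borel_probs" using \<pi> by (simp add: couplings_def)
  note d = dual_feasibleD[OF assms]
  have KXY: "compact (UNIV :: ('x \<times> 'y) set)"
    using compact_Times[OF KX KY] by simp
  have c: "continuous_on UNIV (\<lambda>z :: 'x \<times> 'y. \<alpha> (fst z))" "continuous_on UNIV (\<lambda>z :: 'x \<times> 'y. \<beta> (snd z))"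
    by (auto intro!: continuous_intros continuous_on_compose2[OF d(1)] continuous_on_compose2[OF d(2)])
  have "dual_value \<mu> \<nu> \<alpha> \<beta> = (\<integral>z. \<alpha> (fst z) + \<beta> (snd z) \<partial>\<pi>)"
    using integrable_continuous[OF KXY \<pi>'] c couplings_integral[OF \<pi>] d by (simp add: dual_value_def)
  also have "ennreal \<dots> \<le> transport_cost c' \<pi>"
    unfolding transport_cost_def
    by (rule integral_le_nn_integral_of_minorant[OF KXY \<pi>'])
       (use c c' d(3) in \<open>auto intro: continuous_on_add\<close>)
  finally show "ennreal (dual_value \<mu> \<nu> \<alpha> \<beta>) \<le> transport_cost c' \<pi>" .
qed

lemma dual_value_le_of_ot_cost_le:
  assumes "(\<alpha>, \<beta>) \<in> dual_feasible c'" "ot_cost c' \<mu> \<nu> \<le> ennreal t" "0 \<le> t"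
  shows "dual_value \<mu> \<nu> \<alpha> \<beta> \<le> t"
  using order_trans[OF dual_value_le_ot_cost[OF assms(1)] assms(2)] assms(3)
  by (simp add: ennreal_le_iff)

text \<open>Strong duality: with the one-point set \<open>{mean \<mu>}\<close> the first marginal
  found must be \<open>\<mu>\<close>, since integrals of continuous functions separate Borel
  probability measures.\<close>

lemma coupling_of_dual_bound_fixed_marginals:
  assumes \<mu>: "\<mu> \<in> borel_probs" and \<nu>: "\<nu> \<in> borel_probs"
    and bound: "\<And>\<alpha> \<beta>. (\<alpha>, \<beta>) \<in> dual_feasible c' \<Longrightarrow> dual_value \<mu> \<nu> \<alpha> \<beta> \<le> t"
  shows "\<exists>\<pi>\<in>couplings \<mu> \<nu>. transport_cost c' \<pi> \<le> ennreal t"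
proof -
  have "\<exists>S\<in>{mean \<mu>}. S \<alpha> + (\<integral>y. \<beta> y \<partial>\<nu>) \<le> t" if "(\<alpha>, \<beta>) \<in> dual_feasible c'" for \<alpha> \<beta>
    using bound[OF that] dual_feasibleD(1)[OF that] by (simp add: dual_value_def mean_continuous)
  moreover have "(\<lambda>f. (1 - u) * S f + u * S' f) \<in> {mean \<mu>}"
    if "S \<in> {mean \<mu>}" "S' \<in> {mean \<mu>}" for S S' and u :: real
    using that by (simp add: algebra_simps)
  moreover have "{mean \<mu>} \<subseteq> states"
    using mean_in_states[OF KX \<mu>] by simp
  ultimately have "\<exists>\<mu>'\<in>borel_probs. mean \<mu>' \<in> {mean \<mu>} \<and>
      (\<exists>\<pi>\<in>couplings \<mu>' \<nu>. transport_cost c' \<pi> \<le> ennreal t)"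
    by (intro coupling_of_dual_bound[OF KX KY c' \<nu>]) simp_all
  then obtain \<mu>' \<pi> where *: "\<mu>' \<in> borel_probs" "mean \<mu>' = mean \<mu>" "\<pi> \<in> couplings \<mu>' \<nu>"
    "transport_cost c' \<pi> \<le> ennreal t" by blast
  then have "\<mu>' = \<mu>"
    using \<mu> mean_continuous by (metis borel_probs_eqI)
  with * show ?thesis by blast
qed

end

text \<open>Duality for the zero cost supplies a coupling directly on the Borel sets of the product,
  without comparing them with the product sigma-algebra.\<close>

lemma couplings_nonempty:
  fixes \<mu> :: "'x::metric_space measure" and \<nu> :: "'y::metric_space measure"
  assumes KX: "compact (UNIV :: 'x set)" and KY: "compact (UNIV :: 'y set)"
    and \<mu>: "\<mu> \<in> borel_probs" and \<nu>: "\<nu> \<in> borel_probs"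
  shows "couplings \<mu> \<nu> \<noteq> {}"
proof -
  interpret M: prob_space \<mu> using \<mu> by (simp add: mem_borel_probs_iff)
  interpret N: prob_space \<nu> using \<nu> by (simp add: mem_borel_probs_iff)
  have "dual_value \<mu> \<nu> \<alpha> \<beta> \<le> 0" if "(\<alpha>, \<beta>) \<in> dual_feasible (\<lambda>_ :: 'x \<times> 'y. 0)" for \<alpha> \<beta>
  proof -
    note d = dual_feasibleD[OF that]
    have int: "integrable \<mu> \<alpha>" "integrable \<nu> \<beta>"
      using integrable_continuous KX KY \<mu> \<nu> d by blast+
    \<comment> \<open>The variables separate, so each can be integrated on its own.\<close>
    have "\<alpha> x \<le> - \<beta> y" for x y
      using d(3)[of x y] by simp
    then have "(\<integral>x. \<alpha> x \<partial>\<mu>) \<le> - \<beta> y" for y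
      by (intro M.integral_le_const int AE_I2)
    then have "\<beta> y \<le> - (\<integral>x. \<alpha> x \<partial>\<mu>)" for y
      by (simp add: le_minus_iff)
    then have "(\<integral>y. \<beta> y \<partial>\<nu>) \<le> - (\<integral>x. \<alpha> x \<partial>\<mu>)"
      by (intro N.integral_le_const int AE_I2)
    then show ?thesis by (simp add: dual_value_def)
  qed
  then show ?thesis
    using coupling_of_dual_bound_fixed_marginals[OF KX KY _ _ \<mu> \<nu>, of "\<lambda>_. 0" 0]
    by (auto simp: lower_semicontinuous_def)
qed

text \<open>A finite infimum bounds all dual values by weak duality, and strong duality returns a
  coupling of that cost. If the infimum is infinite, any coupling attains it.\<close>

lemma ot_cost_attained:
  fixes c' :: "'x::metric_space \<times> 'y::metric_space \<Rightarrow> real"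
  assumes KX: "compact (UNIV :: 'x set)" and KY: "compact (UNIV :: 'y set)"
    and c': "\<And>z. 0 \<le> c' z" "lower_semicontinuous c'"
    and \<mu>: "\<mu> \<in> borel_probs" and \<nu>: "\<nu> \<in> borel_probs"
  shows "\<exists>\<pi>\<in>couplings \<mu> \<nu>. transport_cost c' \<pi> = ot_cost c' \<mu> \<nu>"
proof -
  have "\<exists>\<pi>\<in>couplings \<mu> \<nu>. transport_cost c' \<pi> \<le> ot_cost c' \<mu> \<nu>"
  proof (cases "ot_cost c' \<mu> \<nu>")
    case (real t)
    then show ?thesis
      using coupling_of_dual_bound_fixed_marginals[OF KX KY c' \<mu> \<nu>, of t]
        dual_value_le_of_ot_cost_le[OF KX KY c', of _ _ \<mu> \<nu> t] by simp
  next
    case top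
    then show ?thesis using couplings_nonempty[OF KX KY \<mu> \<nu>] by auto
  qed
  then show ?thesis
    unfolding ot_cost_def by (meson INF_lower antisym)
qed

text \<open>By duality the ball is cut out of the probability measures by affine inequalities, which makes
  it convex and compact without having to glue or mix couplings.\<close>

lemma ot_ball_iff:
  fixes c :: "'x::metric_space \<times> 'x \<Rightarrow> real"
  assumes K: "compact (UNIV :: 'x set)"
    and c: "\<And>z. 0 \<le> c z" "lower_semicontinuous c"
    and \<mu>0: "\<mu>0 \<in> borel_probs" and \<delta>: "0 \<le> \<delta>"
  shows "\<mu> \<in> ot_ball c \<delta> \<mu>0 \<longleftrightarrow>
    \<mu> \<in> borel_probs \<and> (\<forall>(\<alpha>, \<beta>)\<in>dual_feasible c. dual_value \<mu>0 \<mu> \<alpha> \<beta> \<le> \<delta>)"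
proof safe
  assume \<mu>: "\<mu> \<in> ot_ball c \<delta> \<mu>0"
  then show "\<mu> \<in> borel_probs" by (simp add: ot_ball_def)
  fix \<alpha> \<beta> assume "(\<alpha>, \<beta>) \<in> dual_feasible c"
  then show "dual_value \<mu>0 \<mu> \<alpha> \<beta> \<le> \<delta>"
    using dual_value_le_of_ot_cost_le[OF K K c] \<mu> \<delta> by (auto simp: ot_ball_def)
next
  assume \<mu>: "\<mu> \<in> borel_probs" and "\<forall>(\<alpha>, \<beta>)\<in>dual_feasible c. dual_value \<mu>0 \<mu> \<alpha> \<beta> \<le> \<delta>"
  then obtain \<pi> where "\<pi> \<in> couplings \<mu>0 \<mu>" "transport_cost c \<pi> \<le> ennreal \<delta>"
    using coupling_of_dual_bound_fixed_marginals[OF K K c \<mu>0 \<mu>, of \<delta>] by blast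
  then have "ot_cost c \<mu>0 \<mu> \<le> ennreal \<delta>"
    unfolding ot_cost_def by (meson INF_lower order_trans)
  with \<mu> show "\<mu> \<in> ot_ball c \<delta> \<mu>0" by (simp add: ot_ball_def)
qed

section \<open>The ball is nonempty; duality for the robust problem\<close>

text \<open>In the dual description it suffices to restrict feasibility to the diagonal, where the
  cost vanishes, and to integrate.\<close>

lemma center_in_ot_ball:
  fixes c :: "'x::metric_space \<times> 'x \<Rightarrow> real"
  assumes K: "compact (UNIV :: 'x set)"
    and c: "\<And>z. 0 \<le> c z" "lower_semicontinuous c" and diag: "\<And>x. c (x, x) = 0"
    and \<mu>0: "\<mu>0 \<in> borel_probs" and \<delta>: "0 \<le> \<delta>"
  shows "\<mu>0 \<in> ot_ball c \<delta> \<mu>0"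
  unfolding ot_ball_iff[OF K c \<mu>0 \<delta>]
proof (safe intro!: \<mu>0)
  interpret prob_space \<mu>0 using \<mu>0 by (simp add: mem_borel_probs_iff)
  fix \<alpha> \<beta> assume d: "(\<alpha>, \<beta>) \<in> dual_feasible c"
  have int: "integrable \<mu>0 \<alpha>" "integrable \<mu>0 \<beta>"
    using integrable_continuous[OF K \<mu>0] dual_feasibleD[OF d] by blast+
  have "\<alpha> x + \<beta> x \<le> 0" for x
    using dual_feasibleD(3)[OF d, of x x] by (simp add: diag)
  then have "(\<integral>x. \<alpha> x + \<beta> x \<partial>\<mu>0) \<le> 0"
    using int by (intro integral_le_const) auto
  then show "dual_value \<mu>0 \<mu>0 \<alpha> \<beta> \<le> \<delta>"
    using int \<delta> by (simp add: dual_value_def)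
qed

text \<open>The equation is stated in \<open>ereal\<close> because single dual values may be
  negative. The other conjuncts say that the infima of the definitions, and the inner one on the
  dual side, are minima.\<close>

theorem theorem1:
  fixes c' :: "'x::metric_space \<times> 'y::metric_space \<Rightarrow> real"
    and c :: "'x \<times> 'x \<Rightarrow> real"
    and \<mu>0 :: "'x measure" and \<nu> :: "'y measure" and \<delta> :: real
  assumes "compact (UNIV :: 'x set)" and "compact (UNIV :: 'y set)"
    and "\<And>x y. 0 \<le> c' (x, y)" and "lower_semicontinuous c'"
    and "\<And>w x. 0 \<le> c (w, x)" and "lower_semicontinuous c" and "\<And>x. c (x, x) = 0"
    and "\<mu>0 \<in> borel_probs" and "\<nu> \<in> borel_probs" and "0 \<le> \<delta>"
  shows
    "enn2ereal (robust_ot c' c \<delta> \<mu>0 \<nu>) =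
       (SUP (\<alpha>, \<beta>)\<in>dual_feasible c'. INF \<mu>\<in>ot_ball c \<delta> \<mu>0. ereal (dual_value \<mu> \<nu> \<alpha> \<beta>))
     \<and> (\<forall>\<mu>\<in>borel_probs. \<exists>\<pi>\<in>couplings \<mu> \<nu>. transport_cost c' \<pi> = ot_cost c' \<mu> \<nu>)
     \<and> (\<forall>\<mu>\<in>borel_probs. \<exists>\<pi>\<in>couplings \<mu>0 \<mu>. transport_cost c \<pi> = ot_cost c \<mu>0 \<mu>)
     \<and> (\<exists>\<mu>\<in>ot_ball c \<delta> \<mu>0. ot_cost c' \<mu> \<nu> = robust_ot c' c \<delta> \<mu>0 \<nu>)
     \<and> (\<forall>(\<alpha>, \<beta>)\<in>dual_feasible c'. \<exists>\<mu>\<in>ot_ball c \<delta> \<mu>0. \<forall>\<mu>'\<in>ot_ball c \<delta> \<mu>0.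
          dual_value \<mu> \<nu> \<alpha> \<beta> \<le> dual_value \<mu>' \<nu> \<alpha> \<beta>)"
proof -
  note KX = assms(1) and KY = assms(2) and \<mu>0 = assms(8) and \<nu> = assms(9) and \<delta> = assms(10)
  have c': "\<And>z. 0 \<le> c' z" "lower_semicontinuous c'" and c: "\<And>z. 0 \<le> c z" "lower_semicontinuous c"
    using assms(3-6) by auto
  let ?ball = "ot_ball c \<delta> \<mu>0"
  note ball_iff = ot_ball_iff[OF KX c \<mu>0 \<delta>]
  have center: "\<mu>0 \<in> ?ball"
    by (rule center_in_ot_ball[OF KX c assms(7) \<mu>0 \<delta>])
  \<comment> \<open>The ball seen among the states, through the inequalities of
    \<open>ot_ball_iff\<close>.\<close>
  define Q where "Q = {S\<in>states. \<forall>(\<alpha>, \<beta>)\<in>dual_feasible c. (\<integral>x. \<alpha> x \<partial>\<mu>0) + S \<beta> \<le> \<delta>}"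
  have mean_Q: "mean \<mu> \<in> Q \<longleftrightarrow> \<mu> \<in> ?ball" if \<mu>: "\<mu> \<in> borel_probs" for \<mu>
    using mean_in_states[OF KX \<mu>] \<mu> dual_feasibleD(2)
    by (fastforce simp: Q_def ball_iff dual_value_def mean_continuous)
  have Q_states: "Q \<subseteq> states" by (auto simp: Q_def)
  have Q_compact: "compact Q"
  proof -
    \<comment> \<open>Each inequality constrains the single coordinate \<open>S \<beta>\<close>,
      hence is closed.\<close>
    have "closed {S. \<forall>\<alpha> \<beta>. (\<alpha>, \<beta>) \<in> dual_feasible c \<longrightarrow> (\<integral>x. \<alpha> x \<partial>\<mu>0) + S \<beta> \<le> \<delta>}"
      by (intro closed_Collect_all closed_Collect_imp open_Collect_const closed_Collect_le
          continuous_on_add continuous_on_const continuous_on_product_coordinates)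
    from compact_Int_closed[OF compact_states[OF KX] this]
    have "compact (states \<inter> {S. \<forall>\<alpha> \<beta>. (\<alpha>, \<beta>) \<in> dual_feasible c \<longrightarrow> (\<integral>x. \<alpha> x \<partial>\<mu>0) + S \<beta> \<le> \<delta>})" .
    also have "states \<inter> {S. \<forall>\<alpha> \<beta>. (\<alpha>, \<beta>) \<in> dual_feasible c \<longrightarrow> (\<integral>x. \<alpha> x \<partial>\<mu>0) + S \<beta> \<le> \<delta>} = Q"
      by (auto simp: Q_def)
    finally show ?thesis .
  qed
  have Q_mix: "(\<lambda>f. (1 - u) * S f + u * S' f) \<in> Q"
    if S: "S \<in> Q" "S' \<in> Q" and u: "0 \<le> u" "u \<le> 1" for S S' u
  proof -
    have "(\<integral>x. \<alpha> x \<partial>\<mu>0) + ((1 - u) * S \<beta> + u * S' \<beta>) \<le> \<delta>" if d: "(\<alpha>, \<beta>) \<in> dual_feasible c" for \<alpha> \<beta>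
    proof -
      have "S \<beta> \<le> \<delta> - (\<integral>x. \<alpha> x \<partial>\<mu>0)" "S' \<beta> \<le> \<delta> - (\<integral>x. \<alpha> x \<partial>\<mu>0)"
        using S d by (fastforce simp: Q_def)+
      then have "(1 - u) * S \<beta> + u * S' \<beta> \<le> \<delta> - (\<integral>x. \<alpha> x \<partial>\<mu>0)"
        using u by (intro convex_bound_le) auto
      then show ?thesis by simp
    qed
    then show ?thesis using S u states_mix by (auto simp: Q_def)
  qed
  have attained: "\<exists>\<mu>\<in>?ball. \<forall>\<mu>'\<in>?ball. dual_value \<mu> \<nu> \<alpha> \<beta> \<le> dual_value \<mu>' \<nu> \<alpha> \<beta>"
    if d: "(\<alpha>, \<beta>) \<in> dual_feasible c'" for \<alpha> \<beta>
  proof -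
    have "Q \<noteq> {}" using center mean_Q[OF \<mu>0] by auto
    \<comment> \<open>Evaluation at \<open>\<alpha>\<close> is a coordinate map, so it attains its
      minimum on the compact set \<open>Q\<close>; the term with \<open>\<nu>\<close> is
      constant.\<close>
    then obtain S where S: "S \<in> Q" "\<And>S'. S' \<in> Q \<Longrightarrow> S \<alpha> \<le> S' \<alpha>"
      using continuous_attains_inf[OF Q_compact _
          continuous_on_subset[OF continuous_on_product_coordinates subset_UNIV], of \<alpha>] by blast
    obtain \<mu> where \<mu>: "\<mu> \<in> borel_probs" "S = mean \<mu>"
      using states_eq_mean[OF KX] S(1) Q_states by blast
    have "dual_value \<mu> \<nu> \<alpha> \<beta> \<le> dual_value \<mu>' \<nu> \<alpha> \<beta>" if "\<mu>' \<in> ?ball" for \<mu>'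
      using S(2)[of "mean \<mu>'"] that mean_Q[of \<mu>'] \<mu>(2) dual_feasibleD(1)[OF d]
      by (auto simp: dual_value_def mean_continuous ball_iff)
    then show ?thesis using S(1) \<mu> mean_Q by blast
  qed
  \<comment> \<open>The exchange of minimum and supremum: one measure of the ball serves all
    feasible pairs.\<close>
  have primal: "\<exists>\<mu>\<in>?ball. ot_cost c' \<mu> \<nu> \<le> ennreal t"
    if bound: "\<And>\<alpha> \<beta>. (\<alpha>, \<beta>) \<in> dual_feasible c' \<Longrightarrow> \<exists>\<mu>\<in>?ball. dual_value \<mu> \<nu> \<alpha> \<beta> \<le> t" for t
  proof -
    have "\<exists>S\<in>Q. S \<alpha> + (\<integral>y. \<beta> y \<partial>\<nu>) \<le> t" if d: "(\<alpha>, \<beta>) \<in> dual_feasible c'" for \<alpha> \<beta>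
    proof -
      obtain \<mu> where "\<mu> \<in> ?ball" "dual_value \<mu> \<nu> \<alpha> \<beta> \<le> t" using bound[OF d] by blast
      then show ?thesis using mean_Q[of \<mu>] dual_feasibleD(1)[OF d]
        by (intro bexI[of _ "mean \<mu>"]) (auto simp: dual_value_def mean_continuous ball_iff)
    qed
    from coupling_of_dual_bound[OF KX KY c' \<nu> Q_states Q_compact Q_mix this]
    obtain \<mu> \<pi> where \<mu>: "\<mu> \<in> borel_probs" "mean \<mu> \<in> Q" and \<pi>: "\<pi> \<in> couplings \<mu> \<nu>" "transport_cost c' \<pi> \<le> ennreal t"
      by blast
    have "ot_cost c' \<mu> \<nu> \<le> ennreal t"
      unfolding ot_cost_def using \<pi> by (meson INF_lower order_trans)
    then show ?thesis using mean_Q[OF \<mu>(1)] \<mu>(2) by blast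
  qed
  have robust_le: "robust_ot c' c \<delta> \<mu>0 \<nu> \<le> ot_cost c' \<mu> \<nu>" if "\<mu> \<in> ?ball" for \<mu>
    unfolding robust_ot_def using that by (rule INF_lower)
  \<comment> \<open>A finite infimum is itself an admissible bound for \<open>primal\<close>, by
    weak duality; if it is infinite, \<open>\<mu>0\<close> is a minimiser.\<close>
  have "\<exists>\<mu>\<in>?ball. ot_cost c' \<mu> \<nu> \<le> robust_ot c' c \<delta> \<mu>0 \<nu>"
  proof (cases "robust_ot c' c \<delta> \<mu>0 \<nu>")
    case (real t)
    have "\<exists>\<mu>\<in>?ball. dual_value \<mu> \<nu> \<alpha> \<beta> \<le> t" if d: "(\<alpha>, \<beta>) \<in> dual_feasible c'" for \<alpha> \<beta>
    proof -
      obtain \<mu> where \<mu>: "\<mu> \<in> ?ball" "\<And>\<mu>'. \<mu>' \<in> ?ball \<Longrightarrow> dual_value \<mu> \<nu> \<alpha> \<beta> \<le> dual_value \<mu>' \<nu> \<alpha> \<beta>"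
        using attained[OF d] by blast
      have "ennreal (dual_value \<mu> \<nu> \<alpha> \<beta>) \<le> robust_ot c' c \<delta> \<mu>0 \<nu>"
        unfolding robust_ot_def
        using \<mu>(2) dual_value_le_ot_cost[OF KX KY c' d]
        by (meson INF_greatest ennreal_leI order_trans)
      then show ?thesis using \<mu>(1) real by (auto simp: ennreal_le_iff)
    qed
    from primal[OF this] show ?thesis using real by simp
  qed (use center in auto)
  then have min: "\<exists>\<mu>\<in>?ball. ot_cost c' \<mu> \<nu> = robust_ot c' c \<delta> \<mu>0 \<nu>"
    using robust_le antisym by blast
  let ?sup = "SUP (\<alpha>, \<beta>)\<in>dual_feasible c'. INF \<mu>\<in>?ball. ereal (dual_value \<mu> \<nu> \<alpha> \<beta>)"
  have sup_upper: "(INF \<mu>\<in>?ball. ereal (dual_value \<mu> \<nu> \<alpha> \<beta>)) \<le> ?sup" if "(\<alpha>, \<beta>) \<in> dual_feasible c'" for \<alpha> \<beta>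
    using SUP_upper[OF that, of "\<lambda>(\<alpha>, \<beta>). INF \<mu>\<in>?ball. ereal (dual_value \<mu> \<nu> \<alpha> \<beta>)"] by simp
  \<comment> \<open>The zero pair excludes a negative supremum, which \<open>ennreal\<close> would
    cut off at 0.\<close>
  have sup_nonneg: "0 \<le> ?sup"
  proof -
    have "(\<lambda>_. 0, \<lambda>_. 0) \<in> dual_feasible c'"
      using c' by (auto simp: dual_feasible_def)
    moreover have "0 \<le> (INF \<mu>\<in>?ball. ereal (dual_value \<mu> \<nu> (\<lambda>_. 0) (\<lambda>_. 0)))"
      by (intro INF_greatest) (simp add: dual_value_def)
    ultimately show ?thesis using sup_upper order_trans by blast
  qed
  have "?sup \<le> enn2ereal (robust_ot c' c \<delta> \<mu>0 \<nu>)"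
  proof (rule SUP_least, clarify)
    fix \<alpha> \<beta> assume d: "(\<alpha>, \<beta>) \<in> dual_feasible c'"
    obtain \<mu> where \<mu>: "\<mu> \<in> ?ball" "ot_cost c' \<mu> \<nu> = robust_ot c' c \<delta> \<mu>0 \<nu>" using min by blast
    have "(INF \<mu>\<in>?ball. ereal (dual_value \<mu> \<nu> \<alpha> \<beta>)) \<le> ereal (dual_value \<mu> \<nu> \<alpha> \<beta>)"
      using \<mu>(1) by (rule INF_lower)
    \<comment> \<open>\<open>ennreal\<close> replaces a negative dual value by 0, hence the
      maximum.\<close>
    also have "\<dots> \<le> ereal (max 0 (dual_value \<mu> \<nu> \<alpha> \<beta>))" by simp
    also have "\<dots> = enn2ereal (ennreal (dual_value \<mu> \<nu> \<alpha> \<beta>))"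
      by (cases "0 \<le> dual_value \<mu> \<nu> \<alpha> \<beta>") (auto simp: ennreal_neg zero_ennreal.rep_eq)
    also have "\<dots> \<le> enn2ereal (robust_ot c' c \<delta> \<mu>0 \<nu>)"
      using dual_value_le_ot_cost[OF KX KY c' d, of \<mu> \<nu>] \<mu>(2) by (simp add: less_eq_ennreal.rep_eq)
    finally show "(INF \<mu>\<in>?ball. ereal (dual_value \<mu> \<nu> \<alpha> \<beta>)) \<le> enn2ereal (robust_ot c' c \<delta> \<mu>0 \<nu>)" .
  qed
  \<comment> \<open>A finite supremum bounds every inner minimum, and these are attained, so
    \<open>primal\<close> applies with its value.\<close>
  moreover have "enn2ereal (robust_ot c' c \<delta> \<mu>0 \<nu>) \<le> ?sup"
  proof (cases ?sup)
    case (real t)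
    then have "0 \<le> t" using sup_nonneg by simp
    have "\<exists>\<mu>\<in>?ball. dual_value \<mu> \<nu> \<alpha> \<beta> \<le> t" if d: "(\<alpha>, \<beta>) \<in> dual_feasible c'" for \<alpha> \<beta>
    proof -
      obtain \<mu> where \<mu>: "\<mu> \<in> ?ball" "\<And>\<mu>'. \<mu>' \<in> ?ball \<Longrightarrow> dual_value \<mu> \<nu> \<alpha> \<beta> \<le> dual_value \<mu>' \<nu> \<alpha> \<beta>"
        using attained[OF d] by blast
      have "ereal (dual_value \<mu> \<nu> \<alpha> \<beta>) \<le> (INF \<mu>\<in>?ball. ereal (dual_value \<mu> \<nu> \<alpha> \<beta>))"
        using \<mu>(2) by (intro INF_greatest) simp
      also have "\<dots> \<le> ereal t" using sup_upper[OF d] real by simp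
      finally show ?thesis using \<mu>(1) by auto
    qed
    from primal[OF this] obtain \<mu> where "\<mu> \<in> ?ball" "ot_cost c' \<mu> \<nu> \<le> ennreal t" by blast
    then have "robust_ot c' c \<delta> \<mu>0 \<nu> \<le> ennreal t"
      using robust_le order_trans by blast
    then show ?thesis
      using real \<open>0 \<le> t\<close> by (simp add: less_eq_ennreal.rep_eq)
  next
    case MInf
    then show ?thesis using sup_nonneg by simp
  qed simp
  ultimately show ?thesis
    using min attained ot_cost_attained[OF KX KY c' _ \<nu>] ot_cost_attained[OF KX KX c \<mu>0]
    by (auto intro: antisym)
qed

end
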